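(* Let $A \in \mathbb{R}^{n\times m}$ with $n \ge m$ and let $Z \in \mathbb{R}^{n\times p}$, $2<p\le\mathrm{rank}(A)$, be given by $Z=A_qG$ with $A_q=(AA^{T})^qA\in\mathbb{R}^{n\times m}$ ($q\in\mathbb{N}$, $q=0$ allowed) and $G\in\mathbb{R}^{m\times p}$ a standard Gaussian matrix. Let $\pi(Z)$ denote the orthogonal projection onto the space spanned by the columns of $Z$. For a given $k\in\{1,\dots,p-2\}$, set $\Omega_k=U_k^{T}Z\in\mathbb{R}^{k\times p}$, with $\Omega_k$ of full row rank (i.e. $\mathrm{rank}(\Omega_k)=k$). Let $\varphi(x)=x/\sqrt{1+x^2}$ for $x\ge0$. Then $$\mathbb{E}\left[\|[I_n-\pi(Z)]A\|_F-\|[I_n-\pi(Z)]\underline{A}_k\|_F\right]\le\min\left\{\sqrt{a_k},\ \sqrt{k}\,\varphi\!\left(\tfrac{1}{\sqrt{k}}\sqrt{b_k}\right)\sigma_1\right\},$$ where, with $\gamma_i=\sigma_{k+1}/\sigma_i$ for $i=1,\dots,\mathrm{rank}(A)$, $$a_k=\frac{\sigma_{k+1}^2}{p-k-1}\left(\sum_{i=k+1}^{\mathrm{rank}(A)}\frac{1}{\gamma_i^{4q+2}}\right)\left(\sum_{i=1}^k\gamma_i^{4q}\right),\qquad b_k=\frac{1}{p-k-1}\left(\sum_{i=k+1}^{\mathrm{rank}(A)}\frac{1}{\gamma_i^{4q+2}}\right)\left(\sum_{i=1}^k\gamma_i^{4q+2}\right).$$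
   Context: $A = U\Sigma V^{T}$ is a singular value decomposition, with $U\in\mathbb{R}^{n\times n}$, $V\in\mathbb{R}^{m\times m}$ orthogonal and $\Sigma\in\mathbb{R}^{n\times m}$ diagonal with singular values $\sigma_1\ge\dots\ge\sigma_m\ge 0$. Partition $U=[U_k\ \ \underline{U}_k]$, $V=[V_k\ \ \underline{V}_k]$, $\Sigma=\mathrm{diag}(\Sigma_k,\underline{\Sigma}_k)$ with $U_k\in\mathbb{R}^{n\times k}$, $V_k\in\mathbb{R}^{m\times k}$, $\Sigma_k=\mathrm{diag}(\sigma_1,\dots,\sigma_k)$, $\underline{\Sigma}_k\in\mathbb{R}^{(n-k)\times(m-k)}$, and set $\underline{A}_k=\underline{U}_k\underline{\Sigma}_k\underline{V}_k^{T}$. A standard Gaussian matrix has independent columns, each distributed as $\mathcal{N}(0,I_m)$. $\|\cdot\|_F$ is the Frobenius norm. *)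

theory Defs
  imports
    "HOL-Probability.Probability"
    "Jordan_Normal_Form.DL_Rank"
begin

(* Matrices are those of Jordan_Normal_Form: dimensions are natural numbers and entries
   are indexed from 0. Singular values keep their usual indices 1, 2, ..., so sigma i
   sits in entry (i - 1, i - 1) of Sigma. *)

abbreviation mat_rank :: "real mat \<Rightarrow> nat" where
  "mat_rank A \<equiv> vec_space.rank (dim_row A) A"

abbreviation column_space :: "real mat \<Rightarrow> real vec set" where
  "column_space Z \<equiv> vec_space.col_space (dim_row Z) Z"

definition frob_norm :: "real mat \<Rightarrow> real" where
  "frob_norm A = sqrt (\<Sum>i<dim_row A. \<Sum>j<dim_col A. (A $$ (i, j))\<^sup>2)"

definition is_orth_proj :: "nat \<Rightarrow> real vec set \<Rightarrow> real mat \<Rightarrow> bool" where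
  "is_orth_proj n W P \<longleftrightarrow> P \<in> carrier_mat n n \<and>
     (\<forall>x \<in> carrier_vec n. P *\<^sub>v x \<in> W \<and> (\<forall>w \<in> W. (x - P *\<^sub>v x) \<bullet> w = 0))"

definition orth_proj :: "real mat \<Rightarrow> real mat" where
  "orth_proj Z = (THE P. is_orth_proj (dim_row Z) (column_space Z) P)"

(* The library's orthogonal_mat only asks for pairwise orthogonal nonzero columns. *)
definition orthogonal_matrix_n :: "nat \<Rightarrow> real mat \<Rightarrow> bool" where
  "orthogonal_matrix_n n U \<longleftrightarrow>
     U \<in> carrier_mat n n \<and> U\<^sup>T * U = 1\<^sub>m n \<and> U * U\<^sup>T = 1\<^sub>m n"

definition sing_mat :: "nat \<Rightarrow> nat \<Rightarrow> (nat \<Rightarrow> real) \<Rightarrow> real mat" where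
  "sing_mat n m \<sigma> = mat n m (\<lambda>(i, j). if i = j then \<sigma> (i + 1) else 0)"

definition is_svd :: "nat \<Rightarrow> nat \<Rightarrow> real mat \<Rightarrow> real mat \<Rightarrow> (nat \<Rightarrow> real) \<Rightarrow> real mat \<Rightarrow> bool" where
  "is_svd n m A U \<sigma> V \<longleftrightarrow>
     orthogonal_matrix_n n U \<and> orthogonal_matrix_n m V \<and>
     (\<forall>i j. 1 \<le> i \<longrightarrow> i \<le> j \<longrightarrow> j \<le> m \<longrightarrow> \<sigma> j \<le> \<sigma> i) \<and>
     (\<forall>i \<in> {1..m}. 0 \<le> \<sigma> i) \<and>
     A = U * sing_mat n m \<sigma> * V\<^sup>T"

definition first_cols :: "nat \<Rightarrow> real mat \<Rightarrow> real mat" where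
  "first_cols k U = mat (dim_row U) k (\<lambda>(i, j). U $$ (i, j))"

definition drop_cols :: "nat \<Rightarrow> real mat \<Rightarrow> real mat" where
  "drop_cols k U = mat (dim_row U) (dim_col U - k) (\<lambda>(i, j). U $$ (i, j + k))"

definition lower_right_block :: "nat \<Rightarrow> real mat \<Rightarrow> real mat" where
  "lower_right_block k S =
     mat (dim_row S - k) (dim_col S - k) (\<lambda>(i, j). S $$ (i + k, j + k))"

(* The SVD tail: the part of A belonging to the singular values after the k-th. *)
definition svd_tail :: "nat \<Rightarrow> nat \<Rightarrow> nat \<Rightarrow> real mat \<Rightarrow> (nat \<Rightarrow> real) \<Rightarrow> real mat \<Rightarrow> real mat" where
  "svd_tail n m k U \<sigma> V =
     drop_cols k U * lower_right_block k (sing_mat n m \<sigma>) * (drop_cols k V)\<^sup>T"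

(* N(0, I_m): the joint law of m independent standard normal variables. *)
definition std_normal_vec :: "nat \<Rightarrow> (nat \<Rightarrow> real) measure" where
  "std_normal_vec m = (\<Pi>\<^sub>M i\<in>{..<m}. density lborel (\<lambda>x. ennreal (std_normal_density x)))"

definition std_gaussian_matrix :: "'w measure \<Rightarrow> nat \<Rightarrow> nat \<Rightarrow> ('w \<Rightarrow> real mat) \<Rightarrow> bool" where
  "std_gaussian_matrix M m p G \<longleftrightarrow>
     (\<forall>\<omega> \<in> space M. G \<omega> \<in> carrier_mat m p) \<and>
     prob_space.indep_vars M (\<lambda>_. \<Pi>\<^sub>M i\<in>{..<m}. borel)
       (\<lambda>j \<omega>. \<lambda>i\<in>{..<m}. G \<omega> $$ (i, j)) {..<p} \<and>
     (\<forall>j<p. distr M (\<Pi>\<^sub>M i\<in>{..<m}. borel) (\<lambda>\<omega>. \<lambda>i\<in>{..<m}. G \<omega> $$ (i, j)) = std_normal_vec m)"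

definition power_mat :: "nat \<Rightarrow> real mat \<Rightarrow> real mat" where
  "power_mat q A = ((A * A\<^sup>T) ^\<^sub>m q) * A"

definition phi :: "real \<Rightarrow> real" where
  "phi x = x / sqrt (1 + x\<^sup>2)"

definition gamma_ratio :: "(nat \<Rightarrow> real) \<Rightarrow> nat \<Rightarrow> nat \<Rightarrow> real" where
  "gamma_ratio \<sigma> k i = \<sigma> (k + 1) / \<sigma> i"

(* In a_bound and b_bound, r is the rank of A. *)
definition a_bound :: "(nat \<Rightarrow> real) \<Rightarrow> nat \<Rightarrow> nat \<Rightarrow> nat \<Rightarrow> nat \<Rightarrow> real" where
  "a_bound \<sigma> r p q k =
     (\<sigma> (k + 1))\<^sup>2 / (real p - real k - 1)
       * (\<Sum>i = k + 1..r. 1 / gamma_ratio \<sigma> k i ^ (4 * q + 2))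
       * (\<Sum>i = 1..k. gamma_ratio \<sigma> k i ^ (4 * q))"

definition b_bound :: "(nat \<Rightarrow> real) \<Rightarrow> nat \<Rightarrow> nat \<Rightarrow> nat \<Rightarrow> nat \<Rightarrow> real" where
  "b_bound \<sigma> r p q k =
     1 / (real p - real k - 1)
       * (\<Sum>i = k + 1..r. 1 / gamma_ratio \<sigma> k i ^ (4 * q + 2))
       * (\<Sum>i = 1..k. gamma_ratio \<sigma> k i ^ (4 * q + 2))"

end

theory Submission
  imports Defs
begin

text \<open>
  Write \<open>P = 1 - \<pi>(Z)\<close> and let \<open>u\<^sub>i\<close>, \<open>v\<^sub>i\<close> be the singular vectors of \<open>A\<close>. By the triangle inequality the
  integrand is at most the Frobenius norm of \<open>P\<close> applied to the leading part of the decomposition, and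
  the square of that norm is \<open>\<Sum>i\<le>k. \<sigma>\<^sub>i\<^sup>2 |P u\<^sub>i|\<^sup>2\<close>.

  By rotation invariance the rows \<open>h\<^sub>1, \<dots>, h\<^sub>m\<close> of \<open>V\<^sup>T G\<close> are independent standard Gaussian vectors of
  dimension \<open>p\<close>, and \<open>Z = U S V\<^sup>T G\<close> with \<open>S = diag(s\<^sub>a)\<close>, \<open>s\<^sub>a = \<sigma>\<^sub>a\<^bsup>2q+1\<^esup>\<close>. Let \<open>y\<^sub>i\<close> be the component of \<open>h\<^sub>i\<close>
  orthogonal to the other rows among the first \<open>k\<close>. Comparing \<open>u\<^sub>i\<close> with multiples of
  \<open>Z y\<^sub>i\<close> gives \<open>|P u\<^sub>i|\<^sup>2 \<le> \<tau>\<^sub>i / (1 + \<tau>\<^sub>i)\<close>, where \<open>\<tau>\<^sub>i = \<Sum>a>k. (s\<^sub>a / s\<^sub>i)\<^sup>2 (h\<^sub>a \<bullet> y\<^sub>i / |y\<^sub>i|\<^sup>2)\<^sup>2\<close>. Given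
  the first \<open>k\<close> rows, \<open>(h\<^sub>a \<bullet> y\<^sub>i / |y\<^sub>i|\<^sup>2)\<^sup>2\<close> has mean \<open>1 / |y\<^sub>i|\<^sup>2\<close>, and \<open>|y\<^sub>i|\<^sup>2\<close> is
  chi-square with \<open>p - k + 1\<close> degrees of freedom, so the mean of \<open>1 / |y\<^sub>i|\<^sup>2\<close> is \<open>1 / (p - k - 1)\<close>. Both bounds
  follow from \<open>E\<surd>X \<le> \<surd>(E X)\<close>: the first from \<open>\<tau> / (1 + \<tau>) \<le> \<tau>\<close>, the second from the concavity of
  \<open>\<tau> / (1 + \<tau>)\<close>.
\<close>

section \<open>Orthogonal residuals\<close>

text \<open>Vectors are plain functions of which only the values below \<open>n\<close> count, so
  points of product measures and columns of matrices can be used without conversion.\<close>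

definition ip :: "nat \<Rightarrow> (nat \<Rightarrow> real) \<Rightarrow> (nat \<Rightarrow> real) \<Rightarrow> real" where
  "ip n x y = (\<Sum>i<n. x i * y i)"

definition orthonormal :: "nat \<Rightarrow> nat \<Rightarrow> (nat \<Rightarrow> nat \<Rightarrow> real) \<Rightarrow> bool" where
  "orthonormal n s e \<longleftrightarrow> (\<forall>a<s. \<forall>b<s. ip n (e a) (e b) = of_bool (a = b))"

text \<open>The component of \<open>x\<close> orthogonal to the vectors in the list. A vector that depends on the later
  ones makes the divisor 0, and division by 0 then drops it, as it should.\<close>

primrec resid :: "nat \<Rightarrow> (nat \<Rightarrow> real) list \<Rightarrow> (nat \<Rightarrow> real) \<Rightarrow> nat \<Rightarrow> real" where
  "resid n [] x = x"
| "resid n (b # L) x =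
     (let y = resid n L b in (\<lambda>i. resid n L x i - ip n (resid n L x) y / ip n y y * y i))"

lemma ip_commute: "ip n x y = ip n y x"
  by (simp add: ip_def mult.commute)

lemma ip_cong: "(\<And>i. i < n \<Longrightarrow> x i = x' i) \<Longrightarrow> (\<And>i. i < n \<Longrightarrow> y i = y' i) \<Longrightarrow> ip n x y = ip n x' y'"
  by (simp add: ip_def)

lemma ip_nonneg: "0 \<le> ip n x x"
  by (simp add: ip_def sum_nonneg)

lemma ip_eq_0_iff: "ip n x x = 0 \<longleftrightarrow> (\<forall>i<n. x i = 0)"
  unfolding ip_def by (subst sum_nonneg_eq_0_iff) auto

lemma ip_diff_left: "ip n (\<lambda>i. x i - y i) z = ip n x z - ip n y z"
  by (simp add: ip_def left_diff_distrib sum_subtractf)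

lemma ip_add_right: "ip n z (\<lambda>i. x i + y i) = ip n z x + ip n z y"
  by (simp add: ip_def distrib_left sum.distrib)

lemma ip_restrict [simp]:
  "ip n (restrict x {..<n}) y = ip n x y" "ip n y (restrict x {..<n}) = ip n y x"
  by (auto intro!: ip_cong)

lemma ip_scale_left: "ip n (\<lambda>i. c * x i) z = c * ip n x z"
  by (simp add: ip_def sum_distrib_left mult.assoc)

lemma ip_divide_left: "ip n (\<lambda>i. x i / c) z = ip n x z / c"
  by (simp add: ip_def sum_divide_distrib)

lemma ip_sum_left: "ip n (\<lambda>i. \<Sum>l\<in>S. f l i) z = (\<Sum>l\<in>S. ip n (f l) z)"
  unfolding ip_def by (subst sum.swap) (simp add: sum_distrib_right)

lemma ip_diff_right: "ip n z (\<lambda>i. x i - y i) = ip n z x - ip n z y"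
  using ip_diff_left[of n x y z] by (simp add: ip_commute)

lemma ip_scale_right: "ip n z (\<lambda>i. c * x i) = c * ip n z x"
  using ip_scale_left[of n c x z] by (simp add: ip_commute)

lemma ip_divide_right: "ip n z (\<lambda>i. x i / c) = ip n z x / c"
  using ip_divide_left[of n x c z] by (simp add: ip_commute)

lemma ip_sum_right: "ip n z (\<lambda>i. \<Sum>l\<in>S. f l i) = (\<Sum>l\<in>S. ip n z (f l))"
  using ip_sum_left[of n f S z] by (simp add: ip_commute)

lemmas ip_linear = ip_diff_left ip_scale_left ip_divide_left ip_sum_left
  ip_diff_right ip_scale_right ip_divide_right ip_sum_right

lemma ip_unit_right: "j < n \<Longrightarrow> ip n x (\<lambda>i. of_bool (i = j)) = x j"
  by (simp add: ip_def if_distrib sum.delta of_bool_def cong: if_cong)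

section \<open>Orthonormal families: residuals, completion and Parseval's identity\<close>

lemma ip_orthonormal_resid:
  assumes "orthonormal n s e" and "a < s"
  shows "ip n (\<lambda>i. x i - (\<Sum>l<s. ip n (e l) x * e l i)) (e a) = 0"
proof -
  have "(\<Sum>l<s. ip n (e l) x * ip n (e l) (e a)) = (\<Sum>l<s. if l = a then ip n (e l) x else 0)"
    using assms by (intro sum.cong) (auto simp: orthonormal_def)
  then show ?thesis
    using assms(2) by (simp add: ip_linear ip_commute)
qed

lemma ip_orthonormal_resid_self:
  assumes "orthonormal n s e"
  shows "ip n (\<lambda>i. x i - (\<Sum>l<s. ip n (e l) x * e l i)) (\<lambda>i. x i - (\<Sum>l<s. ip n (e l) x * e l i))
         = ip n x x - (\<Sum>l<s. (ip n (e l) x)\<^sup>2)"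
proof -
  let ?r = "\<lambda>i. x i - (\<Sum>l<s. ip n (e l) x * e l i)"
  have "ip n ?r ?r = ip n ?r x - (\<Sum>l<s. ip n (e l) x * ip n ?r (e l))"
    by (subst ip_diff_right) (simp add: ip_sum_right ip_scale_right)
  also have "\<dots> = ip n ?r x"
    by (simp add: ip_orthonormal_resid[OF assms])
  also have "\<dots> = ip n x x - (\<Sum>l<s. (ip n (e l) x)\<^sup>2)"
    by (simp add: ip_linear power2_eq_square)
  finally show ?thesis .
qed

lemma ip_orthonormal_combination:
  assumes "orthonormal n s e"
  shows "ip n (\<lambda>i. \<Sum>l<s. c l * e l i) (\<lambda>i. \<Sum>l<s. c l * e l i) = (\<Sum>l<s. (c l)\<^sup>2)"
proof -
  have "ip n (\<lambda>i. \<Sum>l<s. c l * e l i) (\<lambda>i. \<Sum>l<s. c l * e l i)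
      = (\<Sum>l<s. c l * (\<Sum>j<s. c j * ip n (e l) (e j)))"
    by (simp only: ip_sum_left ip_scale_left ip_sum_right ip_scale_right)
  also have "\<dots> = (\<Sum>l<s. c l * c l)"
  proof (intro sum.cong refl)
    fix l assume l: "l \<in> {..<s}"
    have "(\<Sum>j<s. c j * ip n (e l) (e j)) = (\<Sum>j<s. if j = l then c j else 0)"
      using assms l by (intro sum.cong) (auto simp: orthonormal_def)
    then show "c l * (\<Sum>j<s. c j * ip n (e l) (e j)) = c l * c l"
      using l by simp
  qed
  finally show ?thesis by (simp add: power2_eq_square)
qed

lemma orthonormal_extend:
  assumes "orthonormal n s e" and "ip n y y = 1" and "\<And>a. a < s \<Longrightarrow> ip n y (e a) = 0"
  shows "orthonormal n (Suc s) (e(s := y))"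
  using assms by (auto simp: orthonormal_def less_Suc_eq ip_commute)

text \<open>The \<open>j\<close>-th summand is the squared distance of the \<open>j\<close>-th unit
  vector from the span of the family, so the sum is the trace of the projection onto the orthogonal
  complement. It yields \<open>s \<le> n\<close>, a unit vector outside the span when
  \<open>s < n\<close>, and completeness when \<open>s = n\<close>.\<close>

lemma orthonormal_resid_trace:
  assumes "orthonormal n s e"
  shows "(\<Sum>j<n. 1 - (\<Sum>l<s. (e l j)\<^sup>2)) = real n - real s"
proof -
  have "(\<Sum>j<n. \<Sum>l<s. (e l j)\<^sup>2) = (\<Sum>l<s. ip n (e l) (e l))"
    unfolding ip_def by (subst sum.swap) (simp add: power2_eq_square)
  also have "\<dots> = real s"
    using assms by (simp add: orthonormal_def)
  finally show ?thesis
    by (simp add: sum_subtractf)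
qed

lemma orthonormal_resid_unit:
  assumes "orthonormal n s e" and "j < n"
  defines "r \<equiv> (\<lambda>i. of_bool (i = j) - (\<Sum>l<s. e l j * e l i))"
  shows "ip n r r = 1 - (\<Sum>l<s. (e l j)\<^sup>2)" and "\<And>a. a < s \<Longrightarrow> ip n r (e a) = 0"
proof -
  have r: "r = (\<lambda>i. of_bool (i = j) - (\<Sum>l<s. ip n (e l) (\<lambda>i. of_bool (i = j)) * e l i))"
    using assms(2) by (simp add: r_def ip_unit_right)
  show "ip n r r = 1 - (\<Sum>l<s. (e l j)\<^sup>2)"
    unfolding r ip_orthonormal_resid_self[OF assms(1)] using assms(2) by (simp add: ip_unit_right)
  show "ip n r (e a) = 0" if "a < s" for a
    unfolding r by (rule ip_orthonormal_resid[OF assms(1) that])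
qed

lemma orthonormal_le:
  assumes "orthonormal n s e"
  shows "s \<le> n"
proof -
  have "0 \<le> (\<Sum>j<n. 1 - (\<Sum>l<s. (e l j)\<^sup>2))"
    by (intro sum_nonneg) (simp flip: orthonormal_resid_unit(1)[OF assms] add: ip_nonneg)
  then show ?thesis
    by (simp add: orthonormal_resid_trace[OF assms])
qed

text \<open>Induction on \<open>s\<close> downwards from \<open>n\<close>: while
  \<open>s < n\<close> the trace is nonzero, so some unit vector has a nonzero residual, and this
  residual, normalised, extends the family.\<close>

lemma orthonormal_completion:
  assumes "orthonormal n s e"
  obtains e' where "orthonormal n n e'" and "\<And>l. l < s \<Longrightarrow> e' l = e l"
proof -
  have "\<exists>e'. orthonormal n n e' \<and> (\<forall>l<s. e' l = e l)"
    using orthonormal_le[OF assms] assms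
  proof (induction s arbitrary: e rule: inc_induct)
    case base
    then show ?case by blast
  next
    case (step s)
    have "(\<Sum>j<n. 1 - (\<Sum>l<s. (e l j)\<^sup>2)) \<noteq> 0"
      using step.hyps by (simp add: orthonormal_resid_trace[OF step.prems])
    then obtain j where j: "j < n" "1 - (\<Sum>l<s. (e l j)\<^sup>2) \<noteq> 0"
      by (auto elim: sum.not_neutral_contains_not_neutral)
    define r where "r = (\<lambda>i. of_bool (i = j) - (\<Sum>l<s. e l j * e l i))"
    note r = orthonormal_resid_unit[OF step.prems j(1), folded r_def]
    have pos: "ip n r r > 0"
      using r(1) j(2) ip_nonneg[of n r] by linarith
    define y where "y = (\<lambda>i. r i / sqrt (ip n r r))"
    have "orthonormal n (Suc s) (e(s := y))"
      using pos r(2) by (intro orthonormal_extend step.prems) (simp_all add: y_def ip_linear)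
    from step.IH[OF this] obtain e' where "orthonormal n n e'" "\<forall>l<Suc s. e' l = (e(s := y)) l"
      by blast
    then show ?case by (intro exI[of _ e']) auto
  qed
  with that show ?thesis by blast
qed

text \<open>For \<open>s = n\<close> the trace is 0 and its summands are nonnegative, so every unit
  vector has residual 0; read coordinate by coordinate, this gives the relations between the
  columns.\<close>

lemma orthonormal_full_columns:
  assumes "orthonormal n n e" and "i < n" and "j < n"
  shows "(\<Sum>l<n. e l i * e l j) = of_bool (i = j)"
proof -
  have nonneg: "0 \<le> 1 - (\<Sum>l<n. (e l j)\<^sup>2)" if "j < n" for j
    by (subst orthonormal_resid_unit(1)[OF assms(1) that, symmetric]) (rule ip_nonneg)
  have "(\<Sum>j<n. 1 - (\<Sum>l<n. (e l j)\<^sup>2)) = 0"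
    by (simp add: orthonormal_resid_trace[OF assms(1)])
  then have "1 - (\<Sum>l<n. (e l j)\<^sup>2) = 0"
    using nonneg assms(3) by (subst (asm) sum_nonneg_eq_0_iff) auto
  then have "\<forall>i<n. of_bool (i = j) - (\<Sum>l<n. e l j * e l i) = 0"
    by (subst (asm) orthonormal_resid_unit(1)[OF assms(1,3), symmetric]) (simp only: ip_eq_0_iff)
  then show ?thesis
    using assms(2) by (simp add: mult.commute)
qed

lemma orthonormal_expansion:
  assumes "orthonormal n n e" and "i < n"
  shows "(\<Sum>l<n. ip n (e l) x * e l i) = x i"
proof -
  have "(\<Sum>l<n. ip n (e l) x * e l i) = (\<Sum>l<n. \<Sum>j<n. x j * (e l j * e l i))"
    by (simp add: ip_def sum_distrib_right) (simp add: mult_ac)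
  also have "\<dots> = (\<Sum>j<n. x j * (\<Sum>l<n. e l j * e l i))"
    by (subst sum.swap) (simp add: sum_distrib_left)
  also have "\<dots> = (\<Sum>j<n. if j = i then x j else 0)"
    using assms by (intro sum.cong) (auto simp: orthonormal_full_columns)
  finally show ?thesis
    using assms(2) by simp
qed

lemma orthonormal_parseval:
  assumes "orthonormal n n e"
  shows "(\<Sum>l<n. (ip n (e l) x)\<^sup>2) = ip n x x"
proof -
  have "ip n x x - (\<Sum>l<n. (ip n (e l) x)\<^sup>2) = ip n (\<lambda>i. 0) (\<lambda>i. 0)"
    unfolding ip_orthonormal_resid_self[OF assms, symmetric]
    by (intro ip_cong) (simp_all add: orthonormal_expansion[OF assms])
  then show ?thesis by (simp add: ip_def)
qed

text \<open>Gram-Schmidt: the nonzero residuals met along the list, normalised, form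
  \<open>e\<close>. A dependent vector adds nothing, so \<open>s\<close> can be smaller than the
  length. Linearity, self-adjointness and the Gaussian computation are all read off from this
  form.\<close>

lemma resid_orthonormal:
  obtains s e where "s \<le> length L" and "orthonormal n s e"
    and "\<And>x i. i < n \<Longrightarrow> resid n L x i = x i - (\<Sum>l<s. ip n (e l) x * e l i)"
    and "\<And>b i. b \<in> set L \<Longrightarrow> i < n \<Longrightarrow> resid n L b i = 0"
proof -
  have "\<exists>s e. s \<le> length L \<and> orthonormal n s e
    \<and> (\<forall>x i. i < n \<longrightarrow> resid n L x i = x i - (\<Sum>l<s. ip n (e l) x * e l i))
    \<and> (\<forall>b\<in>set L. \<forall>i<n. resid n L b i = 0)"
  proof (induction L)
    case Nil
    show ?case by (intro exI[of _ 0]) (simp add: orthonormal_def)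
  next
    case (Cons b L)
    then obtain s e where s: "s \<le> length L" and on: "orthonormal n s e"
      and R: "\<And>x i. i < n \<Longrightarrow> resid n L x i = x i - (\<Sum>l<s. ip n (e l) x * e l i)"
      and Z: "\<And>b i. b \<in> set L \<Longrightarrow> i < n \<Longrightarrow> resid n L b i = 0"
      by blast
    define y where "y = resid n L b"
    have y: "ip n y (e a) = 0" if "a < s" for a
      using ip_orthonormal_resid[OF on that, of b] R by (simp add: y_def cong: ip_cong)
    \<comment> \<open>Since \<open>y\<close> is orthogonal to all of \<open>e\<close>, the residual
      of \<open>x\<close> may be replaced by \<open>x\<close> itself in products with
      \<open>y\<close>.\<close>
    have xy: "ip n (resid n L x) y = ip n y x" for x
    proof -
      have "ip n (resid n L x) y = ip n (\<lambda>i. x i - (\<Sum>l<s. ip n (e l) x * e l i)) y"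
        using R by (intro ip_cong) auto
      also have "\<dots> = ip n x y - (\<Sum>l<s. ip n (e l) x * ip n (e l) y)"
        by (simp add: ip_linear)
      also have "(\<Sum>l<s. ip n (e l) x * ip n (e l) y) = 0"
        using y by (intro sum.neutral) (simp add: ip_commute)
      finally show ?thesis by (simp add: ip_commute)
    qed
    have step: "resid n (b # L) x i = resid n L x i - ip n y x / ip n y y * y i" for x i
      by (simp add: y_def[symmetric] Let_def xy)
    show ?case
    proof (cases "ip n y y = 0")
      case True
      then have "\<forall>i<n. y i = 0" by (simp add: ip_eq_0_iff)
      then have "\<forall>i<n. resid n L b i = 0" and "\<forall>x. \<forall>i<n. resid n (b # L) x i = resid n L x i"
        using True by (simp_all only: step y_def) simp_all
      then show ?thesis using s on R Z
        by (intro exI[of _ s] exI[of _ e]) (simp del: resid.simps)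
    next
      case False
      then have pos: "ip n y y > 0"
        using ip_nonneg[of n y] by linarith
      define u where "u = (\<lambda>i. y i / sqrt (ip n y y))"
      have eq: "resid n (b # L) x i = resid n L x i - ip n u x * u i" for x i
        using pos unfolding step u_def by (simp add: ip_linear)
      show ?thesis
      proof (intro exI conjI allI ballI impI)
        show "Suc s \<le> length (b # L)" using s by simp
        show "orthonormal n (Suc s) (e(s := u))"
          using pos y by (intro orthonormal_extend on) (simp_all add: u_def ip_linear)
        show "resid n (b # L) x i = x i - (\<Sum>l<Suc s. ip n ((e(s := u)) l) x * (e(s := u)) l i)"
          if "i < n" for x i
          using R[OF that] by (simp add: eq del: resid.simps)
        show "resid n (b # L) b' i = 0" if "b' \<in> set (b # L)" "i < n" for b' i
        proof (cases "b' = b")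
          case True
          have "ip n y b = ip n y y" using xy[of b] by (simp add: y_def)
          then show ?thesis using True pos by (simp add: step y_def[symmetric] del: resid.simps)
        next
          case False
          then have b': "b' \<in> set L" using that by simp
          have "ip n y b' = ip n (\<lambda>i. 0) y"
            unfolding xy[of b', symmetric] using Z[OF b'] by (intro ip_cong) auto
          then show ?thesis using Z[OF b' that(2)] by (simp add: step ip_def del: resid.simps)
        qed
      qed
    qed
  qed
  with that show ?thesis by blast
qed

lemma resid_linear:
  assumes "i < n"
  shows "resid n L (\<lambda>i. \<Sum>j\<in>S. c j * f j i) i = (\<Sum>j\<in>S. c j * resid n L (f j) i)"
proof -
  obtain s e where "s \<le> length L" "orthonormal n s e"
    and R: "\<And>x i. i < n \<Longrightarrow> resid n L x i = x i - (\<Sum>l<s. ip n (e l) x * e l i)"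
    and "\<And>b i. b \<in> set L \<Longrightarrow> i < n \<Longrightarrow> resid n L b i = 0"
    by (rule resid_orthonormal[of L n]) blast
  have "(\<Sum>l<s. ip n (e l) (\<lambda>i. \<Sum>j\<in>S. c j * f j i) * e l i)
      = (\<Sum>l<s. \<Sum>j\<in>S. c j * (ip n (e l) (f j) * e l i))"
    by (simp add: ip_linear sum_distrib_right mult.assoc)
  also have "\<dots> = (\<Sum>j\<in>S. c j * (\<Sum>l<s. ip n (e l) (f j) * e l i))"
    by (subst sum.swap) (simp add: sum_distrib_left)
  finally show ?thesis
    using assms by (simp add: R right_diff_distrib sum_subtractf)
qed

lemma resid_cong:
  assumes "i < n" and "\<And>j. j < n \<Longrightarrow> x j = y j"
  shows "resid n L x i = resid n L y i"
proof -
  obtain s e where "s \<le> length L" "orthonormal n s e"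
    and R: "\<And>x i. i < n \<Longrightarrow> resid n L x i = x i - (\<Sum>l<s. ip n (e l) x * e l i)"
    and "\<And>b i. b \<in> set L \<Longrightarrow> i < n \<Longrightarrow> resid n L b i = 0"
    by (rule resid_orthonormal[of L n]) blast
  have "ip n z x = ip n z y" for z using assms(2) by (auto intro: ip_cong)
  then show ?thesis using assms by (simp add: R)
qed

lemma resid_add:
  assumes "i < n"
  shows "resid n L (\<lambda>i. x i + y i) i = resid n L x i + resid n L y i"
  using resid_linear[OF assms, where L=L and S="{0, 1::nat}" and c="\<lambda>_. 1"
      and f="\<lambda>j. if j = 0 then x else y"] by simp

text \<open>The correction subtracted from \<open>ip n x z\<close> is symmetric in \<open>x\<close>
  and \<open>z\<close>, as befits an orthogonal projection.\<close>

lemma ip_resid_commute: "ip n (resid n L x) z = ip n x (resid n L z)"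
proof -
  obtain s e where "s \<le> length L" "orthonormal n s e"
    and R: "\<And>x i. i < n \<Longrightarrow> resid n L x i = x i - (\<Sum>l<s. ip n (e l) x * e l i)"
    and "\<And>b i. b \<in> set L \<Longrightarrow> i < n \<Longrightarrow> resid n L b i = 0"
    by (rule resid_orthonormal[of L n]) blast
  have "ip n (resid n L x) z = ip n (\<lambda>i. x i - (\<Sum>l<s. ip n (e l) x * e l i)) z"
    and "ip n x (resid n L z) = ip n x (\<lambda>i. z i - (\<Sum>l<s. ip n (e l) z * e l i))"
    using R by (auto intro!: ip_cong)
  moreover have "(\<Sum>l<s. ip n (e l) x * ip n (e l) z) = (\<Sum>l<s. ip n (e l) z * ip n x (e l))"
    by (simp add: ip_commute[of n x] mult.commute)
  ultimately show ?thesis by (simp add: ip_linear)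
qed

lemma ip_resid_mem: "b \<in> set L \<Longrightarrow> ip n (resid n L x) b = 0"
proof -
  assume b: "b \<in> set L"
  have Z: "resid n L b i = 0" if "i < n" for i
    by (rule resid_orthonormal[of L n]) (use b that in blast)
  have "ip n (resid n L x) b = ip n x (\<lambda>i. 0)"
    unfolding ip_resid_commute using Z by (intro ip_cong) auto
  then show ?thesis by (simp add: ip_def)
qed

text \<open>Here the coefficients refer to the vectors of \<open>L\<close> themselves rather than to
  an orthonormal family, as the comparison with the columns of \<open>Z\<close> requires.\<close>

lemma resid_span: "\<exists>c. \<forall>i. resid n L x i = x i - (\<Sum>l<length L. c l * (L ! l) i)"
proof (induction L arbitrary: x)
  case Nil
  show ?case by simp
next
  case (Cons b L)
  obtain c where c: "\<And>i. resid n L x i = x i - (\<Sum>l<length L. c l * (L ! l) i)"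
    using Cons.IH by blast
  obtain d where d: "\<And>i. resid n L b i = b i - (\<Sum>l<length L. d l * (L ! l) i)"
    using Cons.IH by blast
  define t where "t = ip n (resid n L x) (resid n L b) / ip n (resid n L b) (resid n L b)"
  \<comment> \<open>Substituting both induction hypotheses gives \<open>b\<close> the coefficient
    \<open>t\<close> and corrects the coefficient of the \<open>l\<close>-th vector of
    \<open>L\<close> by \<open>t * d l\<close>.\<close>
  have "resid n (b # L) x i
      = x i - (\<Sum>l<length (b # L). (case l of 0 \<Rightarrow> t | Suc l \<Rightarrow> c l - t * d l) * ((b # L) ! l) i)" for i
  proof -
    have "resid n (b # L) x i = resid n L x i - t * resid n L b i"
      by (simp add: Let_def t_def)
    also have "\<dots> = x i - (t * b i + (\<Sum>l<length L. (c l - t * d l) * (L ! l) i))"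
      unfolding c d by (simp add: algebra_simps sum_subtractf sum_distrib_left)
    finally show ?thesis
      by (simp add: lessThan_Suc_atMost sum.atMost_shift del: resid.simps)
  qed
  then show ?case by blast
qed

lemma ip_resid_self: "ip n (resid n L x) (resid n L x) = ip n x (resid n L x)"
proof -
  obtain c where c: "\<And>i. resid n L x i = x i - (\<Sum>l<length L. c l * (L ! l) i)"
    using resid_span by blast
  have "ip n (resid n L x) (resid n L x)
      = ip n (\<lambda>i. x i - (\<Sum>l<length L. c l * (L ! l) i)) (resid n L x)"
    using c by (intro ip_cong) auto
  also have "\<dots> = ip n x (resid n L x)"
    by (simp add: ip_linear) (intro sum.neutral ballI, simp add: ip_commute[of n _ "resid n L x"] ip_resid_mem)
  finally show ?thesis .
qed

text \<open>Pythagoras: \<open>z\<close> differs from the residual by a combination of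
  \<open>L\<close>, which is orthogonal to the residual. This least-squares property turns any trial
  combination of columns into an upper bound for a residual.\<close>

lemma ip_resid_le: "ip n (resid n L x) (resid n L x) \<le> ip n z z"
  if "\<And>i. i < n \<Longrightarrow> z i = x i - (\<Sum>l<length L. c l * (L ! l) i)"
proof -
  let ?r = "resid n L x"
  obtain d where d: "\<And>i. ?r i = x i - (\<Sum>l<length L. d l * (L ! l) i)"
    using resid_span by blast
  define w where "w = (\<lambda>i. z i - ?r i)"
  have "ip n w ?r = ip n (\<lambda>i. \<Sum>l<length L. (d l - c l) * (L ! l) i) ?r"
    using that d by (intro ip_cong) (auto simp: w_def algebra_simps sum_subtractf)
  also have "\<dots> = 0"
    by (simp add: ip_linear) (intro sum.neutral ballI, simp add: ip_commute[of n _ ?r] ip_resid_mem)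
  finally have 0: "ip n w ?r = 0" .
  have "0 \<le> ip n w w" by (rule ip_nonneg)
  also have "ip n w w = ip n w z"
    using 0 by (simp add: ip_diff_right[of n w z ?r, folded w_def])
  also have "\<dots> = ip n z z - ip n ?r z"
    by (simp add: w_def ip_diff_left)
  also have "ip n ?r z = ip n ?r ?r"
    using 0 by (simp add: w_def ip_diff_left ip_commute)
  finally show ?thesis by simp
qed

text \<open>The list entries are functions of the sample point, so one statement serves fixed lists,
  lists of Gaussian rows and the columns of \<open>Z\<close>.\<close>

lemma measurable_resid:
  assumes "\<And>b i. b \<in> set L \<Longrightarrow> i < n \<Longrightarrow> (\<lambda>w. b w i) \<in> borel_measurable N"
    and "\<And>i. i < n \<Longrightarrow> (\<lambda>w. x w i) \<in> borel_measurable N" and "i < n"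
  shows "(\<lambda>w. resid n (map (\<lambda>b. b w) L) (x w) i) \<in> borel_measurable N"
  using assms
proof (induction L arbitrary: x i)
  case Nil
  then show ?case by simp
next
  case (Cons b L)
  have 1: "(\<lambda>w. resid n (map (\<lambda>b. b w) L) (x w) i) \<in> borel_measurable N" if "i < n" for i
    using Cons.prems that by (intro Cons.IH) auto
  have 2: "(\<lambda>w. resid n (map (\<lambda>b. b w) L) (b w) i) \<in> borel_measurable N" if "i < n" for i
    using Cons.prems that by (intro Cons.IH) auto
  show ?case
    using 1 2 Cons.prems(3) unfolding ip_def by (auto simp: Let_def ip_def intro!: borel_measurable_diff borel_measurable_times borel_measurable_divide borel_measurable_sum)
qed

section \<open>Gaussian vectors\<close>

abbreviation lborel_vec :: "nat \<Rightarrow> (nat \<Rightarrow> real) measure" where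
  "lborel_vec n \<equiv> \<Pi>\<^sub>M i\<in>{..<n}. lborel"

abbreviation std_normal :: "real measure" where
  "std_normal \<equiv> density lborel (\<lambda>x. ennreal (std_normal_density x))"

text \<open>For an orthonormal \<open>e\<close> with \<open>n\<close> members this is the orthogonal
  map with rows \<open>e\<close>; the restriction makes its values points of the product
  space.\<close>

definition lin_image :: "nat \<Rightarrow> (nat \<Rightarrow> nat \<Rightarrow> real) \<Rightarrow> (nat \<Rightarrow> real) \<Rightarrow> nat \<Rightarrow> real" where
  "lin_image n e x = (\<lambda>l\<in>{..<n}. ip n (e l) x)"

interpretation lborel_vec: product_sigma_finite "\<lambda>i::nat. lborel :: real measure"
  by standard

lemma prob_space_std_normal: "prob_space std_normal"
  by (rule prob_space_normal_density) simp

interpretation std_normal_vec: product_sigma_finite "\<lambda>i::nat. std_normal"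
  by (intro product_sigma_finite.intro prob_space_imp_sigma_finite prob_space_std_normal)

lemma prob_space_std_normal_vec: "prob_space (std_normal_vec n)"
  unfolding std_normal_vec_def by (rule prob_space_PiM) (rule prob_space_std_normal)

lemma sets_lborel_vec: "sets (lborel_vec n) = sets (\<Pi>\<^sub>M i\<in>{..<n}. borel)"
  by (intro sets_PiM_cong) auto

lemma sets_std_normal_vec: "sets (std_normal_vec n) = sets (\<Pi>\<^sub>M i\<in>{..<n}. borel)"
  unfolding std_normal_vec_def by (intro sets_PiM_cong) auto

lemma sigma_finite_lborel_vec: "sigma_finite_measure (lborel_vec n)"
  by (rule lborel_vec.sigma_finite) simp

lemma measurable_ip:
  assumes "\<And>i. i < n \<Longrightarrow> (\<lambda>w. x w i) \<in> borel_measurable N"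
    and "\<And>i. i < n \<Longrightarrow> (\<lambda>w. y w i) \<in> borel_measurable N"
  shows "(\<lambda>w. ip n (x w) (y w)) \<in> borel_measurable N"
  unfolding ip_def using assms by (intro borel_measurable_sum borel_measurable_times) auto

lemma measurable_coordinate [measurable]:
  "i < n \<Longrightarrow> (\<lambda>x. x i) \<in> borel_measurable (\<Pi>\<^sub>M i\<in>{..<n}. borel)"
  by (rule measurable_component_singleton) simp

section \<open>Invariance of Lebesgue measure under translations, reflections and rotations\<close>

lemma lborel_affine_isometry:
  fixes a c :: real
  assumes "\<bar>c\<bar> = 1"
  shows "distr lborel borel (\<lambda>x. a + c * x) = lborel"
proof -
  have "lborel = density (distr lborel borel (\<lambda>x. a + c * x)) (\<lambda>_. 1)"
    using lborel_real_affine[of c a] assms by simp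
  then show ?thesis by (simp add: density_1)
qed

text \<open>It suffices to compare the measures of boxes, where the product structure leaves the
  one-dimensional case. The sign \<open>c = -1\<close> is there for the map
  \<open>y \<mapsto> x - y\<close>, which occurs in the convolution argument for rotations.\<close>

lemma nn_integral_lborel_vec_affine:
  assumes c: "\<bar>c\<bar> = 1" and f: "f \<in> borel_measurable (\<Pi>\<^sub>M i\<in>{..<n}. borel)"
  shows "(\<integral>\<^sup>+x. f (\<lambda>i\<in>{..<n}. a i + c * x i) \<partial>lborel_vec n) = (\<integral>\<^sup>+x. f x \<partial>lborel_vec n)"
proof -
  let ?T = "\<lambda>x. \<lambda>i\<in>{..<n}. a i + c * x i"
  have T: "?T \<in> measurable (lborel_vec n) (lborel_vec n)"
    by (intro measurable_restrict) auto
  have "distr (lborel_vec n) (lborel_vec n) ?T = lborel_vec n"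
  proof (rule lborel_vec.PiM_eqI)
    fix A :: "nat \<Rightarrow> real set" assume A: "\<And>i. i \<in> {..<n} \<Longrightarrow> A i \<in> sets lborel"
    have "emeasure (distr (lborel_vec n) (lborel_vec n) ?T) (Pi\<^sub>E {..<n} A)
        = emeasure (lborel_vec n) (?T -` Pi\<^sub>E {..<n} A \<inter> space (lborel_vec n))"
      using A by (intro emeasure_distr T sets_PiM_I_finite) auto
    also have "?T -` Pi\<^sub>E {..<n} A \<inter> space (lborel_vec n) = (\<Pi>\<^sub>E i\<in>{..<n}. (\<lambda>x. a i + c * x) -` A i)"
      by (auto simp: space_PiM PiE_iff)
    also have "emeasure (lborel_vec n) \<dots> = (\<Prod>i<n. emeasure lborel ((\<lambda>x. a i + c * x) -` A i))"
      using A by (intro lborel_vec.emeasure_PiM) (auto intro!: measurable_sets_borel[of _ borel])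
    also have "\<dots> = (\<Prod>i<n. emeasure lborel (A i))"
    proof (intro prod.cong refl)
      fix i assume "i \<in> {..<n}"
      then have "emeasure lborel ((\<lambda>x. a i + c * x) -` A i)
          = emeasure (distr lborel borel (\<lambda>x. a i + c * x)) (A i)"
        using A by (subst emeasure_distr) auto
      then show "emeasure lborel ((\<lambda>x. a i + c * x) -` A i) = emeasure lborel (A i)"
        by (simp add: lborel_affine_isometry[OF c])
    qed
    finally show "emeasure (distr (lborel_vec n) (lborel_vec n) ?T) (Pi\<^sub>E {..<n} A)
        = (\<Prod>i<n. emeasure lborel (A i))" .
  qed auto
  then have "(\<integral>\<^sup>+x. f x \<partial>lborel_vec n) = (\<integral>\<^sup>+x. f x \<partial>distr (lborel_vec n) (lborel_vec n) ?T)"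
    by simp
  also have "\<dots> = (\<integral>\<^sup>+x. f (?T x) \<partial>lborel_vec n)"
    using f by (intro nn_integral_distr T) (simp add: measurable_cong_sets[OF sets_lborel_vec refl])
  finally show ?thesis ..
qed

lemma measurable_lin_image [measurable]:
  "lin_image n e \<in> measurable (\<Pi>\<^sub>M i\<in>{..<n}. borel) (\<Pi>\<^sub>M i\<in>{..<n}. borel)"
  unfolding lin_image_def by (intro measurable_restrict measurable_ip) auto

lemma ip_lin_image:
  assumes "orthonormal n n e"
  shows "ip n (lin_image n e x) (lin_image n e x) = ip n x x"
proof -
  have "ip n (lin_image n e x) (lin_image n e x) = (\<Sum>l<n. (ip n (e l) x)\<^sup>2)"
    unfolding lin_image_def ip_restrict by (subst ip_def) (simp add: power2_eq_square)
  then show ?thesis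
    by (simp only: orthonormal_parseval[OF assms])
qed

section \<open>Rotation invariance of the Gaussian law\<close>

definition gauss_weight :: "nat \<Rightarrow> (nat \<Rightarrow> real) \<Rightarrow> ennreal" where
  "gauss_weight n x = (\<Prod>i<n. ennreal (std_normal_density (x i)))"

text \<open>In this form the density depends on \<open>x\<close> only through its squared norm,
  hence is unchanged by \<open>lin_image\<close>.\<close>

lemma gauss_weight_eq:
  "gauss_weight n x = ennreal ((1 / sqrt (2 * pi)) ^ n * exp (- ip n x x / 2))"
proof -
  have "gauss_weight n x = ennreal (\<Prod>i<n. std_normal_density (x i))"
    by (simp add: gauss_weight_def prod_ennreal normal_density_nonneg)
  also have "(\<Prod>i<n. std_normal_density (x i)) = (1 / sqrt (2 * pi)) ^ n * exp (- ip n x x / 2)"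
    by (simp add: std_normal_density_def prod.distrib exp_sum[symmetric] ip_def power2_eq_square
        sum_negf sum_divide_distrib prod_dividef power_divide)
  finally show ?thesis .
qed

lemma measurable_gauss_weight [measurable]:
  "gauss_weight n \<in> borel_measurable (\<Pi>\<^sub>M i\<in>{..<n}. borel)"
  unfolding gauss_weight_def by measurable

lemma nn_integral_gauss_weight: "(\<integral>\<^sup>+x. gauss_weight n x \<partial>lborel_vec n) = 1"
proof -
  have "(\<integral>\<^sup>+x. gauss_weight n x \<partial>lborel_vec n)
      = (\<Prod>i<n. \<integral>\<^sup>+x. ennreal (std_normal_density x) \<partial>lborel)"
    unfolding gauss_weight_def by (intro lborel_vec.product_nn_integral_prod) auto
  also have "(\<integral>\<^sup>+x. ennreal (std_normal_density x) \<partial>lborel) = 1"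
    using prob_space.emeasure_space_1[OF prob_space_std_normal] by (simp add: emeasure_density)
  finally show ?thesis by simp
qed

text \<open>Only translation invariance of Lebesgue measure enters here: in the double integral of
  \<open>f x * g (x - e y)\<close>, with \<open>g\<close> a rotation invariant probability density, both inner integrals
  can be evaluated by a translation.\<close>

lemma nn_integral_lborel_vec_lin_image:
  assumes e: "orthonormal n n e" and f: "f \<in> borel_measurable (\<Pi>\<^sub>M i\<in>{..<n}. borel)"
  shows "(\<integral>\<^sup>+x. f (lin_image n e x) \<partial>lborel_vec n) = (\<integral>\<^sup>+x. f x \<partial>lborel_vec n)"
proof -
  let ?L = "lborel_vec n" and ?T = "lin_image n e" and ?g = "gauss_weight n"
  let ?add = "\<lambda>x y. \<lambda>i\<in>{..<n}. x i + 1 * y i" and ?sub = "\<lambda>x y. \<lambda>i\<in>{..<n}. x i + (-1) * y i"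
  let ?B = "\<Pi>\<^sub>M i\<in>{..<n}. borel :: real measure"
  note meas = measurable_cong_sets[OF sets_lborel_vec[of n] refl]
    measurable_cong_sets[OF sets_pair_measure_cong[OF sets_lborel_vec[of n] sets_lborel_vec[of n]] refl]
  \<comment> \<open>The transposed map is a right inverse of \<open>?T\<close>; through it a shift
    by \<open>x\<close> after the rotation becomes a shift by \<open>T' x\<close> before it.\<close>
  define T' where "T' x = (\<lambda>i. \<Sum>l<n. x l * e l i)" for x
  have TT': "ip n (e l) (T' x) = x l" if "l < n" for l x
  proof -
    have "ip n (e l) (T' x) = (\<Sum>j<n. x j * ip n (e l) (e j))"
      by (simp add: T'_def ip_linear)
    also have "\<dots> = (\<Sum>j<n. if j = l then x j else 0)"
      using e that by (intro sum.cong) (auto simp: orthonormal_def)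
    finally show ?thesis using that by simp
  qed
  have add: "?T (?add (T' x) y) = ?add x (?T y)" for x y
    by (rule ext) (simp add: lin_image_def ip_add_right TT')
  have sub_T: "?T (?sub (T' x) y) = ?sub x (?T y)" for x y
    by (rule ext) (simp add: lin_image_def ip_diff_right TT')
  have sub: "?g (?sub x (?T y)) = ?g (?sub (T' x) y)" for x y
    unfolding gauss_weight_eq
    by (simp only: ip_lin_image[OF e, of "?sub (T' x) y", unfolded sub_T])
  \<comment> \<open>The weight does not see the rotation, so the integrand is a function of
    \<open>T' x - y\<close>, and a reflected translation gives the total mass 1.\<close>
  have g_sub: "(\<integral>\<^sup>+y. ?g (?sub x (?T y)) \<partial>?L) = 1" for x
    unfolding sub by (subst nn_integral_lborel_vec_affine) (auto simp: nn_integral_gauss_weight)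
  have fst_m: "(\<lambda>p. fst p i) \<in> borel_measurable (?B \<Otimes>\<^sub>M ?B)" if "i < n" for i
    by (rule measurable_compose[OF measurable_fst measurable_coordinate[OF that]])
  have snd_m: "(\<lambda>p. ?T (snd p) i) \<in> borel_measurable (?B \<Otimes>\<^sub>M ?B)" if "i < n" for i
    by (rule measurable_compose[OF measurable_compose[OF measurable_snd measurable_lin_image]
          measurable_coordinate[OF that]])
  have sub_m: "(\<lambda>p. ?sub (fst p) (?T (snd p))) \<in> measurable (?B \<Otimes>\<^sub>M ?B) ?B"
    using fst_m snd_m by (intro measurable_restrict borel_measurable_add borel_measurable_times) auto
  have add_m: "(\<lambda>p. ?add (fst p) (?T (snd p))) \<in> measurable (?B \<Otimes>\<^sub>M ?B) ?B"
    using fst_m snd_m by (intro measurable_restrict borel_measurable_add borel_measurable_times) auto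
  have m1: "(\<lambda>(x, y). f x * ?g (?sub x (?T y))) \<in> borel_measurable (?L \<Otimes>\<^sub>M ?L)"
    unfolding meas case_prod_beta
    by (intro borel_measurable_times_ennreal measurable_compose[OF measurable_fst f]
        measurable_compose[OF sub_m measurable_gauss_weight])
  have m2: "(\<lambda>(x, y). ?g x * f (?add x (?T y))) \<in> borel_measurable (?L \<Otimes>\<^sub>M ?L)"
    unfolding meas case_prod_beta
    by (intro borel_measurable_times_ennreal measurable_compose[OF add_m f]
        measurable_compose[OF measurable_fst measurable_gauss_weight])
  have sub_mx: "(\<lambda>y. ?g (?sub x (?T y))) \<in> borel_measurable ?L" if "x \<in> space ?L" for x
    using measurable_Pair2[OF measurable_compose[OF sub_m measurable_gauss_weight], of x] that
    by (simp add: meas space_PiM)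
  have add_mx: "(\<lambda>y. f (?add x (?T y))) \<in> borel_measurable ?L" if "x \<in> space ?L" for x
    using measurable_Pair2[OF measurable_compose[OF add_m f], of x] that
    by (simp add: meas space_PiM)
  interpret pair_sigma_finite ?L ?L
    using sigma_finite_lborel_vec by (simp add: pair_sigma_finite_def)
  \<comment> \<open>The total mass 1 of the shifted weight is inserted, the integrals are exchanged,
    \<open>x\<close> is shifted by \<open>?T y\<close>, the integrals are exchanged back, and
    translation invariance in \<open>y\<close> separates the two factors.\<close>
  have "(\<integral>\<^sup>+x. f x \<partial>?L) = (\<integral>\<^sup>+x. f x * (\<integral>\<^sup>+y. ?g (?sub x (?T y)) \<partial>?L) \<partial>?L)"
    by (simp only: g_sub mult_1_right)
  also have "\<dots> = (\<integral>\<^sup>+x. \<integral>\<^sup>+y. f x * ?g (?sub x (?T y)) \<partial>?L \<partial>?L)"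
    by (intro nn_integral_cong nn_integral_cmult[symmetric] sub_mx)
  also have "\<dots> = (\<integral>\<^sup>+y. \<integral>\<^sup>+x. f x * ?g (?sub x (?T y)) \<partial>?L \<partial>?L)"
    using Fubini'[OF m1] by simp
  also have "\<dots> = (\<integral>\<^sup>+y. \<integral>\<^sup>+x. ?g x * f (?add x (?T y)) \<partial>?L \<partial>?L)"
  proof (rule nn_integral_cong)
    fix y assume "y \<in> space ?L"
    then have "(\<lambda>x. f x * ?g (?sub x (?T y))) \<in> borel_measurable ?B"
      using measurable_Pair1[OF m1, of y] by (simp add: meas)
    from nn_integral_lborel_vec_affine[OF _ this, of 1 "?T y"]
    have "(\<integral>\<^sup>+x. f x * ?g (?sub x (?T y)) \<partial>?L)
        = (\<integral>\<^sup>+x. f (?add (?T y) x) * ?g (?sub (?add (?T y) x) (?T y)) \<partial>?L)"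
      by simp
    also have "\<dots> = (\<integral>\<^sup>+x. ?g x * f (?add x (?T y)) \<partial>?L)"
    proof (intro nn_integral_cong)
      fix x assume "x \<in> space ?L"
      then have "?sub (?add (?T y) x) (?T y) = x"
        by (auto simp: space_PiM PiE_iff extensional_def)
      then show "f (?add (?T y) x) * ?g (?sub (?add (?T y) x) (?T y)) = ?g x * f (?add x (?T y))"
        by (simp add: add.commute mult.commute)
    qed
    finally show "(\<integral>\<^sup>+x. f x * ?g (?sub x (?T y)) \<partial>?L) = (\<integral>\<^sup>+x. ?g x * f (?add x (?T y)) \<partial>?L)" .
  qed
  also have "\<dots> = (\<integral>\<^sup>+x. \<integral>\<^sup>+y. ?g x * f (?add x (?T y)) \<partial>?L \<partial>?L)"
    using Fubini'[OF m2] by simp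
  also have "\<dots> = (\<integral>\<^sup>+x. ?g x * (\<integral>\<^sup>+y. f (?T (?add (T' x) y)) \<partial>?L) \<partial>?L)"
    unfolding add by (intro nn_integral_cong nn_integral_cmult add_mx)
  also have "\<dots> = (\<integral>\<^sup>+x. ?g x * (\<integral>\<^sup>+y. f (?T y) \<partial>?L) \<partial>?L)"
    by (subst nn_integral_lborel_vec_affine[where f="\<lambda>y. f (?T y)"])
      (auto intro: measurable_compose[OF measurable_lin_image f])
  also have "\<dots> = (\<integral>\<^sup>+y. f (?T y) \<partial>?L)"
    by (subst nn_integral_multc) (simp_all add: meas nn_integral_gauss_weight)
  finally show ?thesis ..
qed

lemma std_normal_vec_eq_density: "std_normal_vec n = density (lborel_vec n) (gauss_weight n)"
proof -
  have "density (lborel_vec n) (gauss_weight n) = PiM {..<n} (\<lambda>_. std_normal)"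
  proof (rule std_normal_vec.PiM_eqI)
    show "sets (density (lborel_vec n) (gauss_weight n)) = sets (PiM {..<n} (\<lambda>_. std_normal))"
      by (simp, intro sets_PiM_cong) auto
    fix A :: "nat \<Rightarrow> real set" assume "\<And>i. i \<in> {..<n} \<Longrightarrow> A i \<in> sets std_normal"
    then have A: "\<And>i. i < n \<Longrightarrow> A i \<in> sets borel" by auto
    have "emeasure (density (lborel_vec n) (gauss_weight n)) (Pi\<^sub>E {..<n} A)
        = (\<integral>\<^sup>+x. gauss_weight n x * indicator (Pi\<^sub>E {..<n} A) x \<partial>lborel_vec n)"
      using A by (intro emeasure_density sets_PiM_I_finite)
        (auto simp: measurable_cong_sets[OF sets_lborel_vec refl])
    also have "\<dots> = (\<integral>\<^sup>+x. (\<Prod>i<n. ennreal (std_normal_density (x i)) * indicator (A i) (x i)) \<partial>lborel_vec n)"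
      by (intro nn_integral_cong)
        (auto simp: gauss_weight_def prod.distrib space_PiM PiE_iff indicator_def
          intro!: prod.neutral split: if_splits)
    also have "\<dots> = (\<Prod>i<n. \<integral>\<^sup>+x. ennreal (std_normal_density x) * indicator (A i) x \<partial>lborel)"
      using A by (intro lborel_vec.product_nn_integral_prod) auto
    also have "\<dots> = (\<Prod>i<n. emeasure std_normal (A i))"
      using A by (intro prod.cong refl) (simp add: emeasure_density)
    finally show "emeasure (density (lborel_vec n) (gauss_weight n)) (Pi\<^sub>E {..<n} A)
        = (\<Prod>i<n. emeasure std_normal (A i))" .
  qed simp
  then show ?thesis by (simp add: std_normal_vec_def)
qed

text \<open>Both the Gaussian weight and Lebesgue measure are invariant under the rotation, hence so
  is the measure with this density.\<close>

lemma nn_integral_std_normal_vec_lin_image: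
  assumes e: "orthonormal n n e" and f: "f \<in> borel_measurable (\<Pi>\<^sub>M i\<in>{..<n}. borel)"
  shows "(\<integral>\<^sup>+x. f (lin_image n e x) \<partial>std_normal_vec n) = (\<integral>\<^sup>+x. f x \<partial>std_normal_vec n)"
proof -
  note meas = measurable_cong_sets[OF sets_lborel_vec[of n] refl]
  have "(\<integral>\<^sup>+x. f (lin_image n e x) \<partial>std_normal_vec n)
      = (\<integral>\<^sup>+x. gauss_weight n x * f (lin_image n e x) \<partial>lborel_vec n)"
    unfolding std_normal_vec_eq_density
    using f by (intro nn_integral_density) (auto simp: meas)
  also have "\<dots> = (\<integral>\<^sup>+x. gauss_weight n (lin_image n e x) * f (lin_image n e x) \<partial>lborel_vec n)"
    by (simp add: gauss_weight_eq ip_lin_image[OF e])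
  also have "\<dots> = (\<integral>\<^sup>+x. gauss_weight n x * f x \<partial>lborel_vec n)"
    using f by (intro nn_integral_lborel_vec_lin_image[OF e, of "\<lambda>x. gauss_weight n x * f x"]) simp
  also have "\<dots> = (\<integral>\<^sup>+x. f x \<partial>std_normal_vec n)"
    unfolding std_normal_vec_eq_density
    using f by (intro nn_integral_density[symmetric]) (auto simp: meas)
  finally show ?thesis .
qed

lemma distr_std_normal_vec_lin_image:
  assumes e: "orthonormal n n e"
  shows "distr (std_normal_vec n) (\<Pi>\<^sub>M i\<in>{..<n}. borel) (lin_image n e) = std_normal_vec n"
proof (rule measure_eqI)
  fix A assume "A \<in> sets (distr (std_normal_vec n) (\<Pi>\<^sub>M i\<in>{..<n}. borel) (lin_image n e))"
  then have A: "A \<in> sets (\<Pi>\<^sub>M i\<in>{..<n}. borel)" by simp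
  have m: "lin_image n e \<in> measurable (std_normal_vec n) (\<Pi>\<^sub>M i\<in>{..<n}. borel)"
    by (simp add: measurable_cong_sets[OF sets_std_normal_vec refl])
  have "emeasure (distr (std_normal_vec n) (\<Pi>\<^sub>M i\<in>{..<n}. borel) (lin_image n e)) A
      = (\<integral>\<^sup>+x. indicator A x \<partial>distr (std_normal_vec n) (\<Pi>\<^sub>M i\<in>{..<n}. borel) (lin_image n e))"
    using A by simp
  also have "\<dots> = (\<integral>\<^sup>+x. indicator A (lin_image n e x) \<partial>std_normal_vec n)"
    using A by (intro nn_integral_distr m) simp
  also have "\<dots> = (\<integral>\<^sup>+x. indicator A x \<partial>std_normal_vec n)"
    using A by (intro nn_integral_std_normal_vec_lin_image e) simp
  also have "\<dots> = emeasure (std_normal_vec n) A"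
    using A by (simp add: sets_std_normal_vec)
  finally show "emeasure (distr (std_normal_vec n) (\<Pi>\<^sub>M i\<in>{..<n}. borel) (lin_image n e)) A
      = emeasure (std_normal_vec n) A" .
qed (simp add: sets_std_normal_vec)

section \<open>Exponential, inverse and second moments\<close>

lemma emeasure_lborel_atLeast: "emeasure lborel {a::real..} = \<infinity>"
proof (rule ccontr)
  assume "emeasure lborel {a..} \<noteq> \<infinity>"
  then obtain k :: nat where k: "emeasure lborel {a..} < of_nat k"
    using ennreal_Ex_less_of_nat[of "emeasure lborel {a..}"] by (auto simp: less_top)
  have "of_nat k = emeasure lborel {a..a + real k}"
    by (simp add: ennreal_of_nat_eq_real_of_nat)
  also have "\<dots> \<le> emeasure lborel {a..}"
    by (intro emeasure_mono) auto
  finally show False using k by simp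
qed

text \<open>In \<open>ennreal\<close> the inverse of 0 is \<infinity>, which agrees with the
  integral of the constant 1, so the formula includes \<open>s = 0\<close> and can be integrated
  over all points at once.\<close>

lemma nn_integral_exp_eq_inverse:
  assumes "0 \<le> s"
  shows "(\<integral>\<^sup>+t. ennreal (exp (- t * s)) * indicator {0..} t \<partial>lborel) = inverse (ennreal s)"
proof (cases "s = 0")
  case True
  then show ?thesis by (simp add: emeasure_lborel_atLeast)
next
  case False
  then have s: "s > 0" using assms by simp
  have "(\<integral>\<^sup>+t. ennreal (exp (- t * s)) * indicator {0..} t \<partial>lborel)
      = ennreal (0 - (- exp (- 0 * s) / s))"
  proof (rule nn_integral_FTC_atLeast)
    show "((\<lambda>t. - exp (- t * s) / s) has_real_derivative exp (- t * s)) (at t)" for t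
      using s by (auto intro!: derivative_eq_intros)
    have "filterlim (\<lambda>t. t * s) at_top at_top"
      using s by (simp add: filterlim_at_top_mult_tendsto_pos[OF tendsto_const] mult.commute filterlim_ident)
    then have "((\<lambda>t. exp (- (t * s))) \<longlongrightarrow> 0) at_top"
      by (intro filterlim_compose[OF exp_at_bot] filterlim_compose[OF filterlim_uminus_at_bot_at_top])
    then have "((\<lambda>t. - exp (- (t * s)) / s) \<longlongrightarrow> - 0 / s) at_top"
      using s by (intro tendsto_intros) auto
    then show "((\<lambda>t. - exp (- t * s) / s) \<longlongrightarrow> 0) at_top"
      by simp
  qed auto
  also have "\<dots> = inverse (ennreal s)"
    using s by (simp add: inverse_ennreal inverse_eq_divide)
  finally show ?thesis .
qed

lemma nn_integral_inverse_sqrt_power: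
  assumes "2 < d"
  shows "(\<integral>\<^sup>+t. ennreal ((1 / sqrt (1 + 2 * t)) ^ d) * indicator {0..} t \<partial>lborel)
         = ennreal (1 / (real d - 2))"
proof -
  \<comment> \<open>An antiderivative of the integrand; its exponent \<open>1 - real d / 2\<close>
    is negative for \<open>d > 2\<close>, so it vanishes at infinity.\<close>
  define F where "F t = - ((1 + 2 * t) powr (1 - real d / 2)) / (real d - 2)" for t
  have "(\<integral>\<^sup>+t. ennreal ((1 / sqrt (1 + 2 * t)) ^ d) * indicator {0..} t \<partial>lborel) = ennreal (0 - F 0)"
  proof (rule nn_integral_FTC_atLeast)
    fix t :: real assume t: "0 \<le> t"
    have "(1 / sqrt (1 + 2 * t)) ^ d = (1 + 2 * t) powr (- real d / 2)"
    proof -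
      have "1 / sqrt (1 + 2 * t) = (1 + 2 * t) powr (- 1 / 2)"
        using t by (simp add: powr_half_sqrt powr_minus inverse_eq_divide)
      then have "(1 / sqrt (1 + 2 * t)) ^ d = ((1 + 2 * t) powr (- 1 / 2)) powr real d"
        using t by (simp add: powr_realpow)
      then show ?thesis by (simp add: powr_powr)
    qed
    moreover have "(F has_real_derivative (1 + 2 * t) powr (- real d / 2)) (at t)"
    proof -
      have "((\<lambda>t. (1 + 2 * t) powr (1 - real d / 2)) has_real_derivative
          (1 - real d / 2) * (1 + 2 * t) powr (1 - real d / 2 - 1) * 2) (at t)"
        using t by (auto intro!: derivative_eq_intros)
      then have "(F has_real_derivative
          - ((1 - real d / 2) * (1 + 2 * t) powr (1 - real d / 2 - 1) * 2) / (real d - 2)) (at t)"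
        unfolding F_def by (intro DERIV_cdivide DERIV_minus)
      moreover have "- ((1 - real d / 2) * x * 2) / (real d - 2) = x" for x
        using assms by (simp add: divide_simps) (simp add: algebra_simps)
      ultimately show ?thesis by simp
    qed
    ultimately show "(F has_real_derivative (1 / sqrt (1 + 2 * t)) ^ d) (at t)"
      by simp
    show "0 \<le> (1 / sqrt (1 + 2 * t)) ^ d"
      using t by simp
  next
    have "filterlim (\<lambda>t::real. 1 + 2 * t) at_top at_top"
      by (intro filterlim_tendsto_add_at_top[OF tendsto_const]
          filterlim_tendsto_pos_mult_at_top[OF tendsto_const] filterlim_ident) auto
    then have "((\<lambda>t::real. (1 + 2 * t) powr (1 - real d / 2)) \<longlongrightarrow> 0) at_top"
      using assms by (intro tendsto_neg_powr) auto
    then have "((\<lambda>t::real. - ((1 + 2 * t) powr (1 - real d / 2)) / (real d - 2))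
        \<longlongrightarrow> - 0 / (real d - 2)) at_top"
      using assms by (intro tendsto_intros) auto
    then show "(F \<longlongrightarrow> 0) at_top"
      unfolding F_def by simp
  qed simp
  also have "0 - F 0 = 1 / (real d - 2)"
    by (simp add: F_def)
  finally show ?thesis .
qed

lemma nn_integral_std_normal_exp_square:
  assumes "0 \<le> t"
  shows "(\<integral>\<^sup>+x. ennreal (exp (- t * x\<^sup>2)) \<partial>std_normal) = ennreal (1 / sqrt (1 + 2 * t))"
proof -
  define c where "c = sqrt (1 + 2 * t)"
  have c: "c > 0" "c\<^sup>2 = 1 + 2 * t"
    using assms by (simp_all add: c_def)
  \<comment> \<open>The exponents add up to that of a centred normal density with standard deviation
    \<open>1 / c\<close>, whose normalisation leaves the factor \<open>1 / c\<close>.\<close>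
  have "std_normal_density x * exp (- t * x\<^sup>2) = 1 / c * normal_density 0 (1 / c) x" for x
  proof -
    have "normal_density 0 (1 / c) x = c / sqrt (2 * pi) * exp (- (c\<^sup>2 * x\<^sup>2) / 2)"
      using c(1) by (simp add: normal_density_def power_divide real_sqrt_divide mult.commute)
    also have "exp (- (c\<^sup>2 * x\<^sup>2) / 2) = exp (- x\<^sup>2 / 2) * exp (- t * x\<^sup>2)"
      unfolding c(2) by (simp add: exp_add[symmetric] field_simps)
    finally show ?thesis
      using c(1) by (simp add: std_normal_density_def)
  qed
  then have "(\<integral>\<^sup>+x. ennreal (exp (- t * x\<^sup>2)) \<partial>std_normal)
      = (\<integral>\<^sup>+x. ennreal (1 / c) * ennreal (normal_density 0 (1 / c) x) \<partial>lborel)"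
    using c(1) by (simp add: nn_integral_density ennreal_mult'[symmetric] normal_density_nonneg)
  also have "\<dots> = ennreal (1 / c) * (\<integral>\<^sup>+x. ennreal (normal_density 0 (1 / c) x) \<partial>lborel)"
    by (intro nn_integral_cmult) simp
  also have "(\<integral>\<^sup>+x. ennreal (normal_density 0 (1 / c) x) \<partial>lborel) = 1"
    using prob_space.emeasure_space_1[OF prob_space_normal_density[of "1 / c" 0]] c(1)
    by (simp add: emeasure_density)
  finally show ?thesis by (simp add: c_def)
qed

lemma nn_integral_std_normal_square: "(\<integral>\<^sup>+x. ennreal (x\<^sup>2) \<partial>std_normal) = 1"
proof -
  have "(\<integral>\<^sup>+x. ennreal (x\<^sup>2) \<partial>std_normal)
      = (\<integral>\<^sup>+x. ennreal (std_normal_density x * x ^ (2 * 1)) \<partial>lborel)"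
    by (simp add: nn_integral_density ennreal_mult'[symmetric] normal_density_nonneg)
  also have "\<dots> = ennreal (\<integral>x. std_normal_density x * x ^ (2 * 1) \<partial>lborel)"
    by (intro nn_integral_eq_integral integrable_std_normal_moment)
      (simp add: normal_density_nonneg)
  also have "\<dots> = 1"
    by (subst integral_std_normal_moment_even) (simp add: fact_numeral)
  finally show ?thesis .
qed

lemma nn_integral_std_normal_vec_prod:
  assumes "\<And>l. l < n \<Longrightarrow> f l \<in> borel_measurable borel"
  shows "(\<integral>\<^sup>+x. (\<Prod>l<n. f l (x l)) \<partial>std_normal_vec n) = (\<Prod>l<n. \<integral>\<^sup>+x. f l x \<partial>std_normal)"
  unfolding std_normal_vec_def
  using assms by (intro std_normal_vec.product_nn_integral_prod) auto

lemma measurable_ip_resid_self [measurable]: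
  "(\<lambda>x. ip n (resid n L x) (resid n L x)) \<in> borel_measurable (\<Pi>\<^sub>M i\<in>{..<n}. borel)"
proof -
  have "(\<lambda>x. resid n (map (\<lambda>b. b x) (map (\<lambda>b _. b) L)) x i) \<in> borel_measurable (\<Pi>\<^sub>M i\<in>{..<n}. borel)"
    if "i < n" for i
    by (rule measurable_resid) (use that in auto)
  then show ?thesis
    by (intro measurable_ip) (simp_all add: comp_def)
qed

text \<open>In an orthonormal basis extending the family attached to \<open>L\<close>, the squared
  residual is a sum of \<open>n - s\<close> squares of independent standard normals, so the integral
  is a product of one-dimensional ones. Equality can fail when \<open>L\<close> is dependent: then
  \<open>s < length L\<close>, and additional factors of size at most 1 appear.\<close>

lemma nn_integral_exp_resid_le:
  assumes t: "0 \<le> t"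
  shows "(\<integral>\<^sup>+x. ennreal (exp (- t * ip n (resid n L x) (resid n L x))) \<partial>std_normal_vec n)
         \<le> ennreal ((1 / sqrt (1 + 2 * t)) ^ (n - length L))"
proof -
  obtain s e where s: "s \<le> length L" and on: "orthonormal n s e"
    and R: "\<And>x i. i < n \<Longrightarrow> resid n L x i = x i - (\<Sum>l<s. ip n (e l) x * e l i)"
    and "\<And>b i. b \<in> set L \<Longrightarrow> i < n \<Longrightarrow> resid n L b i = 0"
    by (rule resid_orthonormal[of L n]) blast
  obtain e' where on': "orthonormal n n e'" and e': "\<And>l. l < s \<Longrightarrow> e' l = e l"
    by (rule orthonormal_completion[OF on]) blast
  have sn: "s \<le> n" by (rule orthonormal_le[OF on])
  define f where "f l y = (if l < s then 1 else ennreal (exp (- t * y\<^sup>2)))" for l :: nat and y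
  have eq: "ennreal (exp (- t * ip n (resid n L x) (resid n L x))) = (\<Prod>l<n. f l (lin_image n e' x l))"
    for x
  proof -
    have "ip n (resid n L x) (resid n L x) = ip n x x - (\<Sum>l<s. (ip n (e l) x)\<^sup>2)"
      using R unfolding ip_orthonormal_resid_self[OF on, symmetric] by (intro ip_cong) auto
    also have "\<dots> = (\<Sum>l<n. (ip n (e' l) x)\<^sup>2) - (\<Sum>l<s. (ip n (e' l) x)\<^sup>2)"
      by (simp add: orthonormal_parseval[OF on'] e')
    also have "\<dots> = (\<Sum>l\<in>{..<n} - {..<s}. (ip n (e' l) x)\<^sup>2)"
      using sn by (subst sum_diff) auto
    also have "\<dots> = (\<Sum>l<n. if l < s then 0 else (ip n (e' l) x)\<^sup>2)"
      by (intro sum.mono_neutral_cong_left) auto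
    finally have "exp (- t * ip n (resid n L x) (resid n L x))
        = (\<Prod>l<n. exp (- t * (if l < s then 0 else (ip n (e' l) x)\<^sup>2)))"
      by (simp add: sum_distrib_left exp_sum[symmetric] sum_negf)
    then have "ennreal (exp (- t * ip n (resid n L x) (resid n L x)))
        = (\<Prod>l<n. ennreal (exp (- t * (if l < s then 0 else (ip n (e' l) x)\<^sup>2))))"
      by (simp only: prod_ennreal exp_ge_zero)
    also have "\<dots> = (\<Prod>l<n. f l (lin_image n e' x l))"
      by (intro prod.cong) (auto simp: f_def lin_image_def)
    finally show ?thesis .
  qed
  have f_m: "f l \<in> borel_measurable borel" for l
    unfolding f_def by (cases "l < s") auto
  have "(\<integral>\<^sup>+x. ennreal (exp (- t * ip n (resid n L x) (resid n L x))) \<partial>std_normal_vec n)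
      = (\<integral>\<^sup>+x. (\<Prod>l<n. f l (x l)) \<partial>std_normal_vec n)"
    unfolding eq
    by (intro nn_integral_std_normal_vec_lin_image on' borel_measurable_prod_ennreal
        measurable_compose[OF measurable_coordinate f_m]) simp
  also have "\<dots> = (\<Prod>l<n. \<integral>\<^sup>+x. f l x \<partial>std_normal)"
    by (intro nn_integral_std_normal_vec_prod f_m)
  also have "\<dots> = (\<Prod>l<n. if l < s then 1 else ennreal (1 / sqrt (1 + 2 * t)))"
    using prob_space.emeasure_space_1[OF prob_space_std_normal]
    by (intro prod.cong refl) (auto simp: f_def nn_integral_std_normal_exp_square[OF t, simplified])
  also have "\<dots> = (\<Prod>l\<in>{..<n} - {..<s}. ennreal (1 / sqrt (1 + 2 * t)))"
    by (intro prod.mono_neutral_cong_right) auto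
  also have "\<dots> = ennreal ((1 / sqrt (1 + 2 * t)) ^ (n - s))"
    using sn t by (simp add: card_Diff_subset ennreal_power)
  also have "\<dots> \<le> ennreal ((1 / sqrt (1 + 2 * t)) ^ (n - length L))"
    using s t by (intro ennreal_leI power_decreasing) auto
  finally show ?thesis .
qed

text \<open>Writing \<open>1 / s\<close> as the integral of \<open>exp (- t s)\<close> over \<open>t \<ge> 0\<close> replaces the density of the
  chi-square distribution.\<close>

lemma nn_integral_inverse_resid_le:
  assumes "length L + 2 < n"
  shows "(\<integral>\<^sup>+x. inverse (ennreal (ip n (resid n L x) (resid n L x))) \<partial>std_normal_vec n)
         \<le> ennreal (1 / (real n - real (length L) - 2))"
proof -
  let ?q = "\<lambda>x. ip n (resid n L x) (resid n L x)" and ?N = "std_normal_vec n"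
  interpret N: prob_space ?N by (rule prob_space_std_normal_vec)
  interpret pair_sigma_finite ?N lborel
    by (intro pair_sigma_finite.intro N.sigma_finite_measure_axioms lborel.sigma_finite_measure_axioms)
  have q_m: "?q \<in> borel_measurable ?N"
    by (simp add: measurable_cong_sets[OF sets_std_normal_vec refl])
  have m: "(\<lambda>(x, t). ennreal (exp (- t * ?q x)) * indicator {0..} t)
      \<in> borel_measurable (?N \<Otimes>\<^sub>M lborel)"
    using measurable_compose[OF measurable_fst q_m, of lborel] by measurable
  have "(\<integral>\<^sup>+x. inverse (ennreal (?q x)) \<partial>?N)
      = (\<integral>\<^sup>+x. \<integral>\<^sup>+t. ennreal (exp (- t * ?q x)) * indicator {0..} t \<partial>lborel \<partial>?N)"
    by (simp only: nn_integral_exp_eq_inverse[OF ip_nonneg])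
  also have "\<dots> = (\<integral>\<^sup>+t. \<integral>\<^sup>+x. ennreal (exp (- t * ?q x)) * indicator {0..} t \<partial>?N \<partial>lborel)"
    using Fubini'[OF m] by simp
  also have "\<dots> \<le> (\<integral>\<^sup>+t. ennreal ((1 / sqrt (1 + 2 * t)) ^ (n - length L)) * indicator {0..} t \<partial>lborel)"
  proof (rule nn_integral_mono)
    fix t :: real
    show "(\<integral>\<^sup>+x. ennreal (exp (- t * ?q x)) * indicator {0..} t \<partial>?N)
        \<le> ennreal ((1 / sqrt (1 + 2 * t)) ^ (n - length L)) * indicator {0..} t"
      using nn_integral_exp_resid_le[of t n L] by (auto simp: indicator_def)
  qed
  also have "\<dots> = ennreal (1 / (real (n - length L) - 2))"
    using assms by (intro nn_integral_inverse_sqrt_power) simp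
  also have "real (n - length L) - 2 = real n - real (length L) - 2"
    using assms by simp
  finally show ?thesis .
qed

text \<open>After a rotation taking \<open>w / |w|\<close> to the first basis vector, the inner
  product is \<open>|w|\<close> times one standard normal variable, which has second moment
  1.\<close>

lemma nn_integral_ip_square:
  "(\<integral>\<^sup>+x. ennreal ((ip n w x)\<^sup>2) \<partial>std_normal_vec n) = ennreal (ip n w w)"
proof (cases "ip n w w = 0")
  case True
  then have "\<forall>i<n. w i = 0"
    by (simp only: ip_eq_0_iff)
  then have "ip n w x = 0" for x
    by (simp add: ip_def)
  then show ?thesis by (simp add: True)
next
  case False
  define c where "c = ip n w w"
  have c: "c > 0" using False ip_nonneg[of n w] by (simp add: c_def)
  define u where "u = (\<lambda>i. w i / sqrt c)"
  have on: "orthonormal n 1 (\<lambda>_. u)"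
    using c by (simp add: orthonormal_def u_def ip_linear c_def[symmetric])
  obtain e where e: "orthonormal n n e" and e0: "\<And>l. l < 1 \<Longrightarrow> e l = u"
    by (rule orthonormal_completion[OF on]) blast
  have n: "0 < n" using orthonormal_le[OF on] by simp
  define f where "f l y = (if l = 0 then ennreal (y\<^sup>2) else 1)" for l :: nat and y
  have eq: "ennreal ((ip n w x)\<^sup>2) = ennreal c * (\<Prod>l<n. f l (lin_image n e x l))" for x
  proof -
    have "(\<Prod>l<n. f l (lin_image n e x l)) = ennreal ((ip n u x)\<^sup>2)"
      using n e0[of 0] by (simp add: f_def lin_image_def prod.delta[of _ 0])
    moreover have "(ip n w x)\<^sup>2 = c * (ip n u x)\<^sup>2"
      using c by (simp add: u_def ip_linear power_divide)
    ultimately show ?thesis using c by (simp add: ennreal_mult')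
  qed
  have f_m: "f l \<in> borel_measurable borel" for l
    unfolding f_def by (cases "l = 0") auto
  have F_m: "(\<lambda>x. \<Prod>l<n. f l (x l)) \<in> borel_measurable (\<Pi>\<^sub>M i\<in>{..<n}. borel)"
    using f_m by measurable
  have "(\<integral>\<^sup>+x. ennreal ((ip n w x)\<^sup>2) \<partial>std_normal_vec n)
      = (\<integral>\<^sup>+x. ennreal c * (\<Prod>l<n. f l (x l)) \<partial>std_normal_vec n)"
    unfolding eq using F_m
    by (intro nn_integral_std_normal_vec_lin_image[OF e, of "\<lambda>x. ennreal c * (\<Prod>l<n. f l (x l))"]) simp
  also have "\<dots> = ennreal c * (\<Prod>l<n. \<integral>\<^sup>+x. f l x \<partial>std_normal)"
    using F_m by (subst nn_integral_cmult)
      (auto simp: measurable_cong_sets[OF sets_std_normal_vec refl] nn_integral_std_normal_vec_prod f_m)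
  also have "(\<Prod>l<n. \<integral>\<^sup>+x. f l x \<partial>std_normal) = 1"
  proof (intro prod.neutral ballI)
    show "(\<integral>\<^sup>+x. f l x \<partial>std_normal) = 1" for l
      using prob_space.emeasure_space_1[OF prob_space_std_normal]
      by (cases "l = 0") (simp_all add: f_def nn_integral_std_normal_square)
  qed
  finally show ?thesis by (simp add: c_def)
qed

section \<open>Gaussian matrices\<close>

text \<open>Divided by its squared norm, this is the \<open>i\<close>-th vector of the basis dual to \<open>h 0, \<dots>, h (k - 1)\<close>.\<close>

definition dual_row :: "nat \<Rightarrow> nat \<Rightarrow> nat \<Rightarrow> (nat \<Rightarrow> nat \<Rightarrow> real) \<Rightarrow> nat \<Rightarrow> real" where
  "dual_row p k i h = resid p (map h (filter (\<lambda>b. b \<noteq> i) [0..<k])) (h i)"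

lemma length_filter_neq_upt: "i < k \<Longrightarrow> length (filter (\<lambda>b. b \<noteq> i) [0..<k]) = k - 1"
proof -
  assume "i < k"
  then have "{b. b < k \<and> [0..<k] ! b \<noteq> i} = {..<k} - {i}" by auto
  then show ?thesis using \<open>i < k\<close> by (simp add: length_filter_conv_card)
qed

lemma dual_row_orthogonal: "b < k \<Longrightarrow> b \<noteq> i \<Longrightarrow> ip p (dual_row p k i h) (h b) = 0"
  unfolding dual_row_def by (rule ip_resid_mem) auto

lemma dual_row_self: "ip p (h i) (dual_row p k i h) = ip p (dual_row p k i h) (dual_row p k i h)"
  unfolding dual_row_def by (rule ip_resid_self[symmetric])

text \<open>With the next lemma this lets one row be integrated out while the others stay fixed: a
  row beyond the first \<open>k\<close> does not affect the dual row, and row \<open>i\<close>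
  enters only as the vector whose residual is taken.\<close>

lemma dual_row_upd: "i < k \<Longrightarrow> k \<le> a \<Longrightarrow> dual_row p k i (h(a := x)) = dual_row p k i h"
  by (auto simp: dual_row_def intro!: arg_cong2[where f="resid p"] map_cong)

lemma dual_row_upd_self:
  "dual_row p k i (h(i := x)) = resid p (map h (filter (\<lambda>b. b \<noteq> i) [0..<k])) x"
  by (auto simp: dual_row_def intro!: fun_cong[where x=x] arg_cong[where f="resid p"] map_cong)

abbreviation std_normal_rows :: "nat \<Rightarrow> nat set \<Rightarrow> (nat \<Rightarrow> nat \<Rightarrow> real) measure" where
  "std_normal_rows p I \<equiv> \<Pi>\<^sub>M a\<in>I. std_normal_vec p"

interpretation std_normal_rows: product_sigma_finite "\<lambda>a::nat. std_normal_vec p" for p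
  by (intro product_sigma_finite.intro prob_space_imp_sigma_finite prob_space_std_normal_vec)

lemma prob_space_std_normal_rows: "prob_space (std_normal_rows p I)"
  by (intro prob_space_PiM prob_space_std_normal_vec)

lemma measurable_std_normal_rows_entry:
  assumes "a \<in> I" and "j < p"
  shows "(\<lambda>h. h a j) \<in> borel_measurable (std_normal_rows p I)"
proof -
  have "(\<lambda>x. x j) \<in> borel_measurable (std_normal_vec p)"
    using assms(2) by (simp add: measurable_cong_sets[OF sets_std_normal_vec refl])
  then show ?thesis
    using assms(1) by (intro measurable_compose[OF measurable_component_singleton])
qed

lemma measurable_dual_row:
  assumes "i < k" and "{..<k} \<subseteq> I" and "j < p"
  shows "(\<lambda>h. dual_row p k i h j) \<in> borel_measurable (std_normal_rows p I)"
proof -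
  let ?L = "filter (\<lambda>b. b \<noteq> i) [0..<k]"
  have "(\<lambda>h. resid p (map (\<lambda>b. b h) (map (\<lambda>b h. h b) ?L)) (h i) j) \<in> borel_measurable (std_normal_rows p I)"
    using assms by (intro measurable_resid) (auto intro!: measurable_std_normal_rows_entry)
  then show ?thesis
    by (simp add: dual_row_def comp_def)
qed

text \<open>Given the other rows, the dual row is the residual of a Gaussian vector with respect to
  a fixed list of \<open>k - 1\<close> vectors, so the inverse moment bound applies with
  \<open>p - (k - 1) - 2 = p - k - 1\<close>.\<close>

lemma nn_integral_inverse_dual_row_le:
  assumes "i < k" and "k + 1 < p" and "finite I" and "{..<k} \<subseteq> I"
  shows "(\<integral>\<^sup>+h. inverse (ennreal (ip p (dual_row p k i h) (dual_row p k i h))) \<partial>std_normal_rows p I)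
         \<le> ennreal (1 / (real p - real k - 1))"
proof -
  let ?f = "\<lambda>h. inverse (ennreal (ip p (dual_row p k i h) (dual_row p k i h)))"
  have I: "I = insert i (I - {i})" using assms by auto
  have f: "?f \<in> borel_measurable (std_normal_rows p I)"
    using measurable_dual_row[OF assms(1,4)]
    by (intro borel_measurable_inverse_ennreal measurable_compose[OF _ measurable_ennreal] measurable_ip) auto
  have "(\<integral>\<^sup>+h. ?f h \<partial>std_normal_rows p I)
      = (\<integral>\<^sup>+h. \<integral>\<^sup>+x. ?f (h(i := x)) \<partial>std_normal_vec p \<partial>std_normal_rows p (I - {i}))"
    using assms(3) f I std_normal_rows.product_nn_integral_insert[of "I - {i}" i ?f p] by simp
  also have "\<dots> \<le> (\<integral>\<^sup>+h. ennreal (1 / (real p - real k - 1)) \<partial>std_normal_rows p (I - {i}))"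
  proof (rule nn_integral_mono)
    fix h
    have "real (k - 1) + 2 = real k + 1" using assms(1) by simp
    then have "real p - real (k - 1) - 2 = real p - real k - 1" by linarith
    then show "(\<integral>\<^sup>+x. ?f (h(i := x)) \<partial>std_normal_vec p) \<le> ennreal (1 / (real p - real k - 1))"
      using nn_integral_inverse_resid_le[of "map h (filter (\<lambda>b. b \<noteq> i) [0..<k])" p] assms(1,2)
      by (simp add: dual_row_upd_self length_filter_neq_upt)
  qed
  also have "\<dots> = ennreal (1 / (real p - real k - 1))"
    using prob_space.emeasure_space_1[OF prob_space_std_normal_rows] by simp
  finally show ?thesis .
qed

text \<open>Given the other rows, the quotient is a linear form in the Gaussian row \<open>a\<close>
  with coefficient vector \<open>y / |y|^2\<close>, so its second moment is
  \<open>1 / |y|^2\<close>; the preceding bound then applies to the remaining rows.\<close>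

lemma nn_integral_dual_row_square_le:
  assumes "i < k" and "k + 1 < p" and "finite I" and "{..<k} \<subseteq> I" and "a \<in> I" and "k \<le> a"
  shows "(\<integral>\<^sup>+h. ennreal ((ip p (dual_row p k i h) (h a) / ip p (dual_row p k i h) (dual_row p k i h))\<^sup>2)
            \<partial>std_normal_rows p I)
         \<le> ennreal (1 / (real p - real k - 1))"
proof -
  let ?y = "dual_row p k i"
  let ?f = "\<lambda>h. ennreal ((ip p (?y h) (h a) / ip p (?y h) (?y h))\<^sup>2)"
  have I: "I = insert a (I - {a})" and I': "{..<k} \<subseteq> I - {a}" using assms by auto
  have f: "?f \<in> borel_measurable (std_normal_rows p I)"
    using measurable_dual_row[OF assms(1,4)] measurable_std_normal_rows_entry[OF assms(5)]
    by (intro measurable_compose[OF _ measurable_ennreal] borel_measurable_power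
        borel_measurable_divide measurable_ip) auto
  have "(\<integral>\<^sup>+h. ?f h \<partial>std_normal_rows p I)
      = (\<integral>\<^sup>+h. \<integral>\<^sup>+x. ?f (h(a := x)) \<partial>std_normal_vec p \<partial>std_normal_rows p (I - {a}))"
    using assms(3) f I std_normal_rows.product_nn_integral_insert[of "I - {a}" a ?f p] by simp
  also have "\<dots> \<le> (\<integral>\<^sup>+h. inverse (ennreal (ip p (?y h) (?y h))) \<partial>std_normal_rows p (I - {a}))"
  proof (rule nn_integral_mono)
    fix h
    let ?c = "ip p (?y h) (?y h)"
    have "(\<integral>\<^sup>+x. ?f (h(a := x)) \<partial>std_normal_vec p)
        = (\<integral>\<^sup>+x. ennreal ((ip p (\<lambda>j. ?y h j / ?c) x)\<^sup>2) \<partial>std_normal_vec p)"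
      using assms(1,6) by (simp add: dual_row_upd ip_divide_left)
    also have "\<dots> = ennreal (ip p (\<lambda>j. ?y h j / ?c) (\<lambda>j. ?y h j / ?c))"
      by (rule nn_integral_ip_square)
    also have "ip p (\<lambda>j. ?y h j / ?c) (\<lambda>j. ?y h j / ?c) = inverse ?c"
      by (simp add: ip_linear inverse_eq_divide)
    \<comment> \<open>For a zero dual row the real inverse is 0 and the \<open>ennreal\<close>
      inverse is \<infinity>, so only the inequality holds in general.\<close>
    also have "ennreal (inverse ?c) \<le> inverse (ennreal ?c)"
      using ip_nonneg[of p "?y h"] by (cases "?c = 0") (simp_all add: inverse_ennreal)
    finally show "(\<integral>\<^sup>+x. ?f (h(a := x)) \<partial>std_normal_vec p) \<le> inverse (ennreal ?c)" .
  qed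
  also have "\<dots> \<le> ennreal (1 / (real p - real k - 1))"
    using assms I' by (intro nn_integral_inverse_dual_row_le) auto
  finally show ?thesis .
qed

text \<open>Independent columns with product laws make all entries jointly independent standard
  normals, and these can then be grouped by rows instead of columns.\<close>

lemma (in prob_space) distr_rows_eq_std_normal_rows:
  assumes ind: "indep_vars (\<lambda>_. \<Pi>\<^sub>M i\<in>{..<m}. borel) C {..<p}"
    and law: "\<And>j. j < p \<Longrightarrow> distr M (\<Pi>\<^sub>M i\<in>{..<m}. borel) (C j) = std_normal_vec m"
    and "0 < m" and "0 < p"
  shows "distr M (std_normal_rows p {..<m}) (\<lambda>\<omega>. \<lambda>a\<in>{..<m}. \<lambda>j\<in>{..<p}. C j \<omega> a) = std_normal_rows p {..<m}"
proof -
  let ?B = "\<lambda>n. \<Pi>\<^sub>M i\<in>{..<n::nat}. borel :: real measure"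
  let ?K = "{..<m} \<times> {..<p}"
  interpret entries: product_sigma_finite "\<lambda>k::nat \<times> nat. std_normal"
    by (intro product_sigma_finite.intro prob_space_imp_sigma_finite prob_space_std_normal)
  have C_m: "C j \<in> measurable M (?B m)" if "j < p" for j
    using ind that by (simp add: indep_vars_def)
  have E_m: "(\<lambda>\<omega>. C j \<omega> a) \<in> borel_measurable M" if "a < m" "j < p" for a j
    using that by (intro measurable_compose[OF C_m measurable_coordinate])
  have E_law: "distr M borel (\<lambda>\<omega>. C j \<omega> a) = std_normal" if "a < m" "j < p" for a j
  proof -
    have "distr M borel (\<lambda>\<omega>. C j \<omega> a) = distr (distr M (?B m) (C j)) borel (\<lambda>x. x a)"
      using that by (subst distr_distr) (auto simp: C_m comp_def)
    also have "\<dots> = distr (PiM {..<m} (\<lambda>_. std_normal)) std_normal (\<lambda>x. x a)"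
      unfolding law[OF that(2)] std_normal_vec_def by (intro distr_cong) simp_all
    also have "\<dots> = std_normal"
      using that by (intro distr_PiM_component[where M="\<lambda>_. std_normal"] prob_space_std_normal) simp
    finally show ?thesis .
  qed
  have "distr M (PiM ?K (\<lambda>_. borel)) (\<lambda>\<omega>. \<lambda>k\<in>?K. C (snd k) \<omega> (fst k)) = PiM ?K (\<lambda>_. std_normal)"
  proof (rule entries.PiM_eqI)
    show "sets (distr M (PiM ?K (\<lambda>_. borel)) (\<lambda>\<omega>. \<lambda>k\<in>?K. C (snd k) \<omega> (fst k)))
        = sets (PiM ?K (\<lambda>_. std_normal))"
      by (simp, intro sets_PiM_cong) auto
    fix A :: "nat \<times> nat \<Rightarrow> real set" assume "\<And>k. k \<in> ?K \<Longrightarrow> A k \<in> sets std_normal"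
    then have A: "\<And>a j. a < m \<Longrightarrow> j < p \<Longrightarrow> A (a, j) \<in> sets borel" by auto
    \<comment> \<open>A box in the space of all entries is the intersection of one event per column,
      so independence of the columns factors its probability.\<close>
    define S where "S j = (\<Pi>\<^sub>E a\<in>{..<m}. A (a, j))" for j
    have S: "S j \<in> sets (?B m)" if "j < p" for j
      unfolding S_def using A that by (intro sets_PiM_I_finite) auto
    have C_ext: "C j \<omega> \<in> extensional {..<m}" if "j < p" "\<omega> \<in> space M" for j \<omega>
      using measurable_space[OF C_m[OF that(1)] that(2)] by (simp add: space_PiM PiE_iff)
    have "emeasure (distr M (PiM ?K (\<lambda>_. borel)) (\<lambda>\<omega>. \<lambda>k\<in>?K. C (snd k) \<omega> (fst k))) (Pi\<^sub>E ?K A)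
        = emeasure M ((\<lambda>\<omega>. \<lambda>k\<in>?K. C (snd k) \<omega> (fst k)) -` Pi\<^sub>E ?K A \<inter> space M)"
      using A E_m by (intro emeasure_distr measurable_restrict sets_PiM_I_finite) auto
    also have "(\<lambda>\<omega>. \<lambda>k\<in>?K. C (snd k) \<omega> (fst k)) -` Pi\<^sub>E ?K A \<inter> space M
        = (\<Inter>j\<in>{..<p}. C j -` S j \<inter> space M)"
      using C_ext \<open>0 < p\<close> by (auto simp: S_def PiE_iff)
    also have "emeasure M \<dots> = ennreal (\<Prod>j<p. prob (C j -` S j \<inter> space M))"
      unfolding emeasure_eq_measure using S \<open>0 < p\<close>
      by (subst indep_varsD_finite[OF ind]) auto
    also have "\<dots> = (\<Prod>j<p. emeasure M (C j -` S j \<inter> space M))"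
      by (simp add: prod_ennreal emeasure_eq_measure)
    also have "\<dots> = (\<Prod>j<p. emeasure (std_normal_vec m) (S j))"
      using S by (intro prod.cong refl) (simp add: law[symmetric] emeasure_distr C_m)
    also have "\<dots> = (\<Prod>j<p. \<Prod>a<m. emeasure std_normal (A (a, j)))"
      unfolding S_def std_normal_vec_def
      using A by (intro prod.cong refl std_normal_vec.emeasure_PiM) auto
    also have "\<dots> = (\<Prod>k\<in>?K. emeasure std_normal (A k))"
      by (subst prod.swap) (simp add: prod.cartesian_product)
    finally show "emeasure (distr M (PiM ?K (\<lambda>_. borel)) (\<lambda>\<omega>. \<lambda>k\<in>?K. C (snd k) \<omega> (fst k))) (Pi\<^sub>E ?K A)
        = (\<Prod>k\<in>?K. emeasure std_normal (A k))" .
  qed simp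
  also have "PiM ?K (\<lambda>_. std_normal) = PiM ?K (\<lambda>k. distr M borel (\<lambda>\<omega>. C (snd k) \<omega> (fst k)))"
    by (intro PiM_cong) (auto simp: E_law)
  finally have ind_entries: "indep_vars (\<lambda>_. borel) (\<lambda>k \<omega>. C (snd k) \<omega> (fst k)) ?K"
    using assms(3,4) E_m by (subst indep_vars_iff_distr_eq_PiM') auto
  \<comment> \<open>Row \<open>a\<close> is a function of the entries with first index
    \<open>a\<close>, and these index blocks are disjoint for different rows.\<close>
  have "indep_vars (\<lambda>a. PiM ({a} \<times> {..<p}) (\<lambda>_. borel))
      (\<lambda>a \<omega>. \<lambda>k\<in>{a} \<times> {..<p}. C (snd k) \<omega> (fst k)) {..<m}"
    by (rule indep_vars_restrict[OF ind_entries]) (auto simp: disjoint_family_on_def)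
  then have "indep_vars (\<lambda>_. ?B p)
      (\<lambda>a \<omega>. \<lambda>j\<in>{..<p}. (\<lambda>k\<in>{a} \<times> {..<p}. C (snd k) \<omega> (fst k)) (a, j)) {..<m}"
    by (rule indep_vars_compose2[where Y="\<lambda>a x. \<lambda>j\<in>{..<p}. x (a, j)"])
      (auto intro!: measurable_restrict measurable_component_singleton)
  then have ind_rows: "indep_vars (\<lambda>_. ?B p) (\<lambda>a \<omega>. \<lambda>j\<in>{..<p}. C j \<omega> a) {..<m}"
    by (subst (asm) indep_vars_cong[where Y="\<lambda>a \<omega>. \<lambda>j\<in>{..<p}. C j \<omega> a"]) (auto simp: fun_eq_iff)
  have row_law: "distr M (?B p) (\<lambda>\<omega>. \<lambda>j\<in>{..<p}. C j \<omega> a) = std_normal_vec p" if "a < m" for a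
  proof -
    have "indep_vars (\<lambda>_. borel) (\<lambda>j \<omega>. C j \<omega> a) {..<p}"
      using that by (intro indep_vars_compose2[OF ind, where Y="\<lambda>_ x. x a"]) simp
    then have "distr M (?B p) (\<lambda>\<omega>. \<lambda>j\<in>{..<p}. C j \<omega> a)
        = PiM {..<p} (\<lambda>j. distr M borel (\<lambda>\<omega>. C j \<omega> a))"
      using assms(4) E_m that by (subst (asm) indep_vars_iff_distr_eq_PiM') auto
    also have "\<dots> = std_normal_vec p"
      unfolding std_normal_vec_def using that by (intro PiM_cong) (auto simp: E_law)
    finally show ?thesis .
  qed
  have "distr M (PiM {..<m} (\<lambda>_. ?B p)) (\<lambda>\<omega>. \<lambda>a\<in>{..<m}. \<lambda>j\<in>{..<p}. C j \<omega> a)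
      = PiM {..<m} (\<lambda>a. distr M (?B p) (\<lambda>\<omega>. \<lambda>j\<in>{..<p}. C j \<omega> a))"
    using ind_rows assms(3) E_m
    by (subst (asm) indep_vars_iff_distr_eq_PiM') (auto intro!: measurable_restrict)
  also have "\<dots> = std_normal_rows p {..<m}"
    by (intro PiM_cong) (auto simp: row_law)
  finally have "distr M (PiM {..<m} (\<lambda>_. ?B p)) (\<lambda>\<omega>. \<lambda>a\<in>{..<m}. \<lambda>j\<in>{..<p}. C j \<omega> a)
      = std_normal_rows p {..<m}" .
  moreover have "distr M (std_normal_rows p {..<m}) (\<lambda>\<omega>. \<lambda>a\<in>{..<m}. \<lambda>j\<in>{..<p}. C j \<omega> a)
      = distr M (PiM {..<m} (\<lambda>_. ?B p)) (\<lambda>\<omega>. \<lambda>a\<in>{..<m}. \<lambda>j\<in>{..<p}. C j \<omega> a)"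
    by (intro distr_cong sets_PiM_cong) (auto simp: sets_std_normal_vec)
  ultimately show ?thesis by simp
qed

text \<open>The rotation acts on each column separately, which preserves both the independence of
  the columns and their law; the preceding lemma then passes to rows.\<close>

lemma (in prob_space) std_gaussian_rows:
  assumes G: "std_gaussian_matrix M m p G" and e: "orthonormal m m e" and "0 < m" and "0 < p"
  shows "(\<lambda>\<omega>. \<lambda>a\<in>{..<m}. \<lambda>j\<in>{..<p}. ip m (e a) (\<lambda>l. G \<omega> $$ (l, j))) \<in> measurable M (std_normal_rows p {..<m})"
    and "distr M (std_normal_rows p {..<m})
           (\<lambda>\<omega>. \<lambda>a\<in>{..<m}. \<lambda>j\<in>{..<p}. ip m (e a) (\<lambda>l. G \<omega> $$ (l, j))) = std_normal_rows p {..<m}"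
proof -
  let ?B = "\<lambda>n. \<Pi>\<^sub>M i\<in>{..<n::nat}. borel :: real measure"
  let ?c = "\<lambda>j \<omega>. \<lambda>i\<in>{..<m}. G \<omega> $$ (i, j)"
  define C where "C j \<omega> = lin_image m e (?c j \<omega>)" for j \<omega>
  have ind: "indep_vars (\<lambda>_. ?B m) ?c {..<p}"
    and law: "\<And>j. j < p \<Longrightarrow> distr M (?B m) (?c j) = std_normal_vec m"
    using G by (auto simp: std_gaussian_matrix_def)
  have c_m: "?c j \<in> measurable M (?B m)" if "j < p" for j
    using ind that by (simp add: indep_vars_def)
  have indC: "indep_vars (\<lambda>_. ?B m) C {..<p}"
    unfolding C_def by (rule indep_vars_compose2[OF ind]) simp
  have lawC: "distr M (?B m) (C j) = std_normal_vec m" if "j < p" for j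
  proof -
    have "distr M (?B m) (C j) = distr (distr M (?B m) (?c j)) (?B m) (lin_image m e)"
      using that by (subst distr_distr) (auto simp: c_m comp_def C_def[abs_def])
    then show ?thesis
      by (simp add: law[OF that] distr_std_normal_vec_lin_image[OF e])
  qed
  have eq: "(\<lambda>\<omega>. \<lambda>a\<in>{..<m}. \<lambda>j\<in>{..<p}. ip m (e a) (\<lambda>l. G \<omega> $$ (l, j)))
      = (\<lambda>\<omega>. \<lambda>a\<in>{..<m}. \<lambda>j\<in>{..<p}. C j \<omega> a)"
    by (auto simp: C_def lin_image_def fun_eq_iff ip_commute)
  show "distr M (std_normal_rows p {..<m})
      (\<lambda>\<omega>. \<lambda>a\<in>{..<m}. \<lambda>j\<in>{..<p}. ip m (e a) (\<lambda>l. G \<omega> $$ (l, j))) = std_normal_rows p {..<m}"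
    unfolding eq by (rule distr_rows_eq_std_normal_rows[OF indC lawC assms(3,4)])
  have "(\<lambda>\<omega>. \<lambda>a\<in>{..<m}. \<lambda>j\<in>{..<p}. C j \<omega> a) \<in> measurable M (PiM {..<m} (\<lambda>_. ?B p))"
  proof (intro measurable_restrict)
    fix a j assume "a \<in> {..<m}" "j \<in> {..<p}"
    then show "(\<lambda>\<omega>. C j \<omega> a) \<in> borel_measurable M"
      unfolding C_def by (intro measurable_compose[OF measurable_compose[OF c_m measurable_lin_image]
            measurable_coordinate]) auto
  qed
  then show "(\<lambda>\<omega>. \<lambda>a\<in>{..<m}. \<lambda>j\<in>{..<p}. ip m (e a) (\<lambda>l. G \<omega> $$ (l, j)))
      \<in> measurable M (std_normal_rows p {..<m})"
    unfolding eq by (subst measurable_cong_sets[OF refl sets_PiM_cong[OF refl sets_std_normal_vec]])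
qed

section \<open>Projections, rank and singular values\<close>

definition column_list :: "real mat \<Rightarrow> (nat \<Rightarrow> real) list" where
  "column_list Z = map (\<lambda>j i. Z $$ (i, j)) [0..<dim_col Z]"

lemma sum_of_bool_mult:
  assumes "i < (n :: nat)"
  shows "(\<Sum>j<n. of_bool (j = i) * f j) = (f i :: real)" "(\<Sum>j<n. of_bool (i = j) * f j) = (f i :: real)"
proof -
  have "(\<Sum>j<n. of_bool (j = i) * f j) = (\<Sum>j<n. if j = i then f j else 0)"
    by (intro sum.cong) auto
  then show "(\<Sum>j<n. of_bool (j = i) * f j) = f i"
    using assms by simp
  then show "(\<Sum>j<n. of_bool (i = j) * f j) = f i"
    by (simp only: eq_commute[of i])
qed

lemma scalar_prod_eq_ip: "dim_vec y = n \<Longrightarrow> x \<bullet> y = ip n (vec_index x) (vec_index y)"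
  by (simp add: scalar_prod_def ip_def atLeast0LessThan)

lemma mem_column_space_iff:
  assumes "Z \<in> carrier_mat n p"
  shows "x \<in> vec_space.col_space n Z \<longleftrightarrow>
    x \<in> carrier_vec n \<and> (\<exists>c. \<forall>i<n. vec_index x i = (\<Sum>l<p. c l * Z $$ (i, l)))"
proof -
  have mult: "vec_index (Z *\<^sub>v y) i = (\<Sum>l<p. vec_index y l * Z $$ (i, l))"
    if "y \<in> carrier_vec p" "i < n" for y i
    using assms that by (auto simp: scalar_prod_def atLeast0LessThan mult.commute intro!: sum.cong)
  show ?thesis
    unfolding vec_space.col_space_eq[OF assms]
  proof (intro iffI conjI)
    assume "x \<in> {y \<in> carrier_vec (dim_row Z). \<exists>x\<in>carrier_vec (dim_col Z). Z *\<^sub>v x = y}"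
    then obtain y where y: "y \<in> carrier_vec p" "x = Z *\<^sub>v y"
      using assms by auto
    show "x \<in> carrier_vec n" using y assms by simp
    show "\<exists>c. \<forall>i<n. vec_index x i = (\<Sum>l<p. c l * Z $$ (i, l))"
      using mult y by (intro exI[of _ "vec_index y"]) auto
  next
    assume "x \<in> carrier_vec n \<and> (\<exists>c. \<forall>i<n. vec_index x i = (\<Sum>l<p. c l * Z $$ (i, l)))"
    then obtain c where x: "x \<in> carrier_vec n"
      and c: "\<And>i. i < n \<Longrightarrow> vec_index x i = (\<Sum>l<p. c l * Z $$ (i, l))" by blast
    have "Z *\<^sub>v vec p c = x"
      using x assms c by (intro eq_vecI) (auto simp: mult simp del: index_mult_mat_vec)
    then show "x \<in> {y \<in> carrier_vec (dim_row Z). \<exists>x\<in>carrier_vec (dim_col Z). Z *\<^sub>v x = y}"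
      using x assms by auto
  qed
qed

section \<open>The projection onto the column space in terms of residuals\<close>

lemma resid_column_list:
  assumes Z: "Z \<in> carrier_mat n p"
  shows "\<exists>c. \<forall>i. resid n (column_list Z) x i = x i - (\<Sum>l<p. c l * Z $$ (i, l))"
    and "l < p \<Longrightarrow> ip n (resid n (column_list Z) x) (\<lambda>i. Z $$ (i, l)) = 0"
proof -
  show "\<exists>c. \<forall>i. resid n (column_list Z) x i = x i - (\<Sum>l<p. c l * Z $$ (i, l))"
    using resid_span[of n "column_list Z" x] Z by (auto simp: column_list_def)
  show "ip n (resid n (column_list Z) x) (\<lambda>i. Z $$ (i, l)) = 0" if "l < p"
    using Z that by (intro ip_resid_mem) (auto simp: column_list_def)
qed

text \<open>The difference \<open>w\<close> of the two candidates lies in the column space and is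
  orthogonal to it, so it vanishes. This gives the uniqueness behind the definite description in
  \<open>orth_proj\<close>, and lets residuals replace the projection in all later
  computations.\<close>

lemma is_orth_proj_resid:
  assumes Z: "Z \<in> carrier_mat n p" and P: "is_orth_proj n (vec_space.col_space n Z) P"
    and x: "x \<in> carrier_vec n" and i: "i < n"
  shows "vec_index (P *\<^sub>v x) i = vec_index x i - resid n (column_list Z) (vec_index x) i"
proof -
  let ?x = "vec_index x" and ?Px = "vec_index (P *\<^sub>v x)" and ?r = "resid n (column_list Z) (vec_index x)"
  have Pc: "P \<in> carrier_mat n n" using P by (simp add: is_orth_proj_def)
  have "P *\<^sub>v x \<in> vec_space.col_space n Z"
    using P x by (simp add: is_orth_proj_def)
  then obtain c where c: "\<And>i. i < n \<Longrightarrow> ?Px i = (\<Sum>l<p. c l * Z $$ (i, l))"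
    using mem_column_space_iff[OF Z] by blast
  obtain d where d: "\<And>i. ?r i = ?x i - (\<Sum>l<p. d l * Z $$ (i, l))"
    using resid_column_list(1)[OF Z] by blast
  have orth: "ip n (\<lambda>i. ?x i - ?Px i) (\<lambda>i. Z $$ (i, l)) = 0" if l: "l < p" for l
  proof -
    have "vec n (\<lambda>i. Z $$ (i, l)) \<in> vec_space.col_space n Z"
      unfolding mem_column_space_iff[OF Z] using l
      by (auto intro!: exI[of _ "\<lambda>j. of_bool (j = l)"] simp: sum_of_bool_mult simp del: sum_of_bool_mult_eq)
    then have "(x - P *\<^sub>v x) \<bullet> vec n (\<lambda>i. Z $$ (i, l)) = 0"
      using P x by (simp add: is_orth_proj_def)
    then have "ip n (vec_index (x - P *\<^sub>v x)) (vec_index (vec n (\<lambda>i. Z $$ (i, l)))) = 0"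
      by (simp add: scalar_prod_eq_ip)
    then show ?thesis
      using x Pc by (simp add: ip_def)
  qed
  define w where "w i = ?x i - ?Px i - ?r i" for i
  have w: "w i = (\<Sum>l<p. (d l - c l) * Z $$ (i, l))" if "i < n" for i
    using that by (simp add: w_def c d left_diff_distrib sum_subtractf)
  have "ip n w w = ip n w (\<lambda>i. \<Sum>l<p. (d l - c l) * Z $$ (i, l))"
    using w by (intro ip_cong) auto
  also have "\<dots> = (\<Sum>l<p. (d l - c l) * (ip n (\<lambda>i. ?x i - ?Px i) (\<lambda>i. Z $$ (i, l)) - ip n ?r (\<lambda>i. Z $$ (i, l))))"
    by (simp add: ip_sum_right ip_scale_right w_def[abs_def] ip_diff_left[of n "\<lambda>i. ?x i - ?Px i"])
  also have "\<dots> = 0"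
    using resid_column_list(2)[OF Z] by (simp add: orth)
  finally have "w i = 0" using i by (simp add: ip_eq_0_iff)
  then show ?thesis by (simp add: w_def)
qed

lemma ex_is_orth_proj:
  assumes Z: "Z \<in> carrier_mat n p"
  shows "\<exists>P. is_orth_proj n (vec_space.col_space n Z) P"
proof -
  let ?L = "column_list Z"
  \<comment> \<open>Column \<open>j\<close> is the \<open>j\<close>-th unit vector minus its
    residual; linearity of \<open>resid\<close> carries this over to arbitrary vectors.\<close>
  define P where "P = mat n n (\<lambda>(i, j). of_bool (i = j) - resid n ?L (\<lambda>i. of_bool (i = j)) i)"
  have Pc: "P \<in> carrier_mat n n" by (simp add: P_def)
  have Px: "vec_index (P *\<^sub>v x) i = vec_index x i - resid n ?L (vec_index x) i"
    if x: "x \<in> carrier_vec n" and i: "i < n" for x i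
  proof -
    have "vec_index (P *\<^sub>v x) i
        = (\<Sum>j<n. (of_bool (i = j) - resid n ?L (\<lambda>i. of_bool (i = j)) i) * vec_index x j)"
      using x i by (simp add: P_def scalar_prod_def atLeast0LessThan)
    also have "\<dots> = (\<Sum>j<n. of_bool (i = j) * vec_index x j)
        - (\<Sum>j<n. vec_index x j * resid n ?L (\<lambda>i. of_bool (i = j)) i)"
      unfolding left_diff_distrib sum_subtractf by (simp only: mult.commute)
    also have "(\<Sum>j<n. of_bool (i = j) * vec_index x j) = vec_index x i"
      using i by (rule sum_of_bool_mult)
    also have "(\<Sum>j<n. vec_index x j * resid n ?L (\<lambda>i. of_bool (i = j)) i)
        = resid n ?L (\<lambda>i. \<Sum>j<n. vec_index x j * of_bool (i = j)) i"
      using i by (rule resid_linear[symmetric])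
    also have "\<dots> = resid n ?L (vec_index x) i"
      using i by (intro resid_cong) (simp_all only: mult.commute[of _ "of_bool _"] sum_of_bool_mult)
    finally show ?thesis .
  qed
  have "is_orth_proj n (vec_space.col_space n Z) P"
    unfolding is_orth_proj_def
  proof (intro conjI ballI Pc)
    fix x :: "real vec" assume x: "x \<in> carrier_vec n"
    obtain d where d: "\<And>i. resid n ?L (vec_index x) i = vec_index x i - (\<Sum>l<p. d l * Z $$ (i, l))"
      using resid_column_list(1)[OF Z] by blast
    show "P *\<^sub>v x \<in> vec_space.col_space n Z"
      unfolding mem_column_space_iff[OF Z]
    proof (intro conjI exI allI impI)
      show "P *\<^sub>v x \<in> carrier_vec n" using x Pc by simp
      show "vec_index (P *\<^sub>v x) i = (\<Sum>l<p. d l * Z $$ (i, l))" if "i < n" for i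
        using Px[OF x that] by (simp add: d)
    qed
    fix w assume "w \<in> vec_space.col_space n Z"
    then obtain c where w: "w \<in> carrier_vec n"
      and c: "\<And>i. i < n \<Longrightarrow> vec_index w i = (\<Sum>l<p. c l * Z $$ (i, l))"
      using mem_column_space_iff[OF Z] by blast
    have "(x - P *\<^sub>v x) \<bullet> w = ip n (vec_index (x - P *\<^sub>v x)) (vec_index w)"
      using w by (simp add: scalar_prod_eq_ip)
    also have "\<dots> = ip n (resid n ?L (vec_index x)) (\<lambda>i. \<Sum>l<p. c l * Z $$ (i, l))"
      using x Pc by (intro ip_cong) (auto simp: Px c simp del: index_mult_mat_vec)
    also have "\<dots> = 0"
      using resid_column_list(2)[OF Z] by (simp add: ip_sum_right ip_scale_right)
    finally show "(x - P *\<^sub>v x) \<bullet> w = 0" .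
  qed
  then show ?thesis ..
qed

lemma is_orth_proj_orth_proj:
  assumes Z: "Z \<in> carrier_mat n p"
  shows "is_orth_proj n (vec_space.col_space n Z) (orth_proj Z)"
proof -
  have "P = Q" if P: "is_orth_proj n (vec_space.col_space n Z) P"
    and Q: "is_orth_proj n (vec_space.col_space n Z) Q" for P Q
  proof (rule eq_matI)
    have c: "P \<in> carrier_mat n n" "Q \<in> carrier_mat n n"
      using P Q by (auto simp: is_orth_proj_def)
    then show "dim_row P = dim_row Q" "dim_col P = dim_col Q" by auto
    fix i j assume "i < dim_row Q" "j < dim_col Q"
    then have ij: "i < n" "j < n" using c by auto
    have "vec_index (P *\<^sub>v unit_vec n j) i = vec_index (Q *\<^sub>v unit_vec n j) i"
      using is_orth_proj_resid[OF Z P, of "unit_vec n j" i] is_orth_proj_resid[OF Z Q, of "unit_vec n j" i] ij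
      by simp
    then show "P $$ (i, j) = Q $$ (i, j)"
      using c ij by simp
  qed
  then have "\<exists>!P. is_orth_proj n (vec_space.col_space n Z) P"
    using ex_is_orth_proj[OF Z] by auto
  then show ?thesis
    using Z unfolding orth_proj_def by (auto intro: theI')
qed

text \<open>The form as one \<open>L2_set\<close> over index pairs makes the triangle inequality for
  \<open>L2_set\<close> available for Frobenius norms.\<close>

lemma frob_norm_orth_proj:
  assumes Z: "Z \<in> carrier_mat n p" and B: "B \<in> carrier_mat n m"
  shows "frob_norm ((1\<^sub>m n - orth_proj Z) * B)
    = L2_set (\<lambda>(j, i). resid n (column_list Z) (\<lambda>i. B $$ (i, j)) i) ({..<m} \<times> {..<n})"
proof -
  have P: "orth_proj Z \<in> carrier_mat n n"
    using is_orth_proj_orth_proj[OF Z] by (simp add: is_orth_proj_def)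
  have eq: "((1\<^sub>m n - orth_proj Z) * B) $$ (i, j) = resid n (column_list Z) (\<lambda>i. B $$ (i, j)) i"
    if "i < n" "j < m" for i j
  proof -
    have "((1\<^sub>m n - orth_proj Z) * B) $$ (i, j) = vec_index ((1\<^sub>m n - orth_proj Z) *\<^sub>v col B j) i"
      using P B that by simp
    also have "(1\<^sub>m n - orth_proj Z) *\<^sub>v col B j = col B j - orth_proj Z *\<^sub>v col B j"
      using P B that by (simp add: minus_mult_distrib_mat_vec[of _ n n])
    also have "vec_index \<dots> i = resid n (column_list Z) (vec_index (col B j)) i"
      using is_orth_proj_resid[OF Z is_orth_proj_orth_proj[OF Z], of "col B j" i] P B that by simp
    also have "\<dots> = resid n (column_list Z) (\<lambda>i. B $$ (i, j)) i"
      using B that by (intro resid_cong) auto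
    finally show ?thesis .
  qed
  have "(\<Sum>i<n. \<Sum>j<m. (((1\<^sub>m n - orth_proj Z) * B) $$ (i, j))\<^sup>2)
      = (\<Sum>j<m. \<Sum>i<n. (resid n (column_list Z) (\<lambda>i. B $$ (i, j)) i)\<^sup>2)"
    by (subst sum.swap) (simp add: eq del: index_mult_mat)
  then show ?thesis
    using P B by (simp add: frob_norm_def L2_set_def sum.cartesian_product case_prod_beta del: index_mult_mat(1))
qed

section \<open>Rank and the number of nonzero singular values\<close>

lemma (in vec_space) cols_in_span_of_rank_many:
  assumes A: "A \<in> carrier_mat n nc"
  obtains U where "finite U" "U \<subseteq> carrier_vec n" "card U = rank A" "set (cols A) \<subseteq> span U"
proof -
  let ?P = "\<lambda>T. T \<subseteq> set (cols A) \<and> lin_indpt T"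
  have carr: "set (cols A) \<subseteq> carrier_vec n" using cols_dim A by blast
  have "?P {}"
    by (metis empty_subsetI fin_dim finite_basis_exists subset_li_is_li vec_vs vectorspace.basis_def)
  \<comment> \<open>A maximal independent set of columns has \<open>rank A\<close> members, and a
    column outside its span could be added to it.\<close>
  then obtain U where U: "maximal U ?P" "finite U"
    using maximal_exists_superset[of "set (cols A)" ?P "{}"] by auto
  have UP: "U \<subseteq> set (cols A)" "lin_indpt U" using U(1) by (auto simp: maximal_def)
  have "s \<in> span U" if s: "s \<in> set (cols A)" for s
  proof (rule ccontr)
    assume ns: "s \<notin> span U"
    have "s \<notin> U" using ns UP carr in_own_span[of U] by auto
    moreover have "lin_indpt (U \<union> {s})"
      using ns UP s carr lin_dep_iff_in_span[of U s] \<open>s \<notin> U\<close> by auto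
    ultimately show False
      using U(1) UP s unfolding maximal_def by blast
  qed
  moreover have "rank A = card U" by (rule rank_card_indpt[OF A U(1)])
  ultimately show ?thesis using that[of U] U(2) UP carr by auto
qed

lemma rank_column_span:
  assumes A: "A \<in> carrier_mat n nc"
  obtains L :: "(nat \<Rightarrow> real) list" where "length L = mat_rank A"
    and "\<And>j. j < nc \<Longrightarrow> \<exists>c. \<forall>i<n. A $$ (i, j) = (\<Sum>l<length L. c l * (L ! l) i)"
proof -
  interpret V: vec_space "TYPE(real)" n .
  obtain U where U: "finite U" "U \<subseteq> carrier_vec n" "card U = V.rank A" "set (cols A) \<subseteq> V.span U"
    by (rule V.cols_in_span_of_rank_many[OF A])
  obtain us where us: "set us = U" "distinct us"
    using finite_distinct_list[OF U(1)] by blast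
  have len: "length us = card U" using us distinct_card by metis
  show ?thesis
  proof (rule that[of "map vec_index us"])
    show "length (map vec_index us) = mat_rank A"
      using A U(3) len by simp
    fix j assume j: "j < nc"
    then have "col A j \<in> V.span U"
      using U(4) A by (auto simp: cols_def)
    then have "\<exists>a. V.lincomb a U = col A j"
      using V.finite_in_span[OF U(1)] U(2) by auto
    then obtain a where a: "col A j = V.lincomb a U"
      by metis
    have "A $$ (i, j) = (\<Sum>l<length us. a (us ! l) * vec_index (us ! l) i)" if i: "i < n" for i
    proof -
      have "A $$ (i, j) = vec_index (V.lincomb a U) i"
        using A i j by (simp flip: a)
      also have "\<dots> = (\<Sum>x\<in>U. a x * vec_index x i)"
        using i U by (intro V.lincomb_index) auto
      also have "\<dots> = (\<Sum>l<length us. a (us ! l) * vec_index (us ! l) i)"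
        using us by (intro sum.reindex_bij_betw[symmetric]) (simp add: bij_betw_nth)
      finally show ?thesis .
    qed
    then show "\<exists>c. \<forall>i<n. A $$ (i, j) = (\<Sum>l<length (map vec_index us). c l * (map vec_index us ! l) i)"
      by (intro exI[of _ "\<lambda>l. a (us ! l)"]) simp
  qed
qed

text \<open>The coordinates of the \<open>u a\<close> in the orthonormal family attached to
  \<open>L\<close> are themselves orthonormal, in dimension \<open>s \<le> length L\<close>, so
  there are at most \<open>s\<close> of them.\<close>

lemma orthonormal_card_le_span:
  assumes u: "orthonormal n r u"
    and span: "\<And>a. a < r \<Longrightarrow> \<exists>c. \<forall>i<n. u a i = (\<Sum>l<length L. c l * (L ! l) i)"
  shows "r \<le> length L"
proof -
  obtain s e where s: "s \<le> length L" and e: "orthonormal n s e"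
    and R: "\<And>x i. i < n \<Longrightarrow> resid n L x i = x i - (\<Sum>l<s. ip n (e l) x * e l i)"
    and "\<And>b i. b \<in> set L \<Longrightarrow> i < n \<Longrightarrow> resid n L b i = 0"
    by (rule resid_orthonormal[of L n]) blast
  have exp: "u a i = (\<Sum>l<s. ip n (e l) (u a) * e l i)" if a: "a < r" and i: "i < n" for a i
  proof -
    obtain c where c: "\<And>i. i < n \<Longrightarrow> u a i = (\<Sum>l<length L. c l * (L ! l) i)"
      using span[OF a] by blast
    \<comment> \<open>Least squares with the trial vector 0: a combination of \<open>L\<close> has
      residual 0.\<close>
    have "ip n (resid n L (u a)) (resid n L (u a)) \<le> ip n (\<lambda>i. 0) (\<lambda>i. 0)"
      using c by (intro ip_resid_le[where c=c]) simp
    then have "ip n (resid n L (u a)) (resid n L (u a)) = 0"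
      using ip_nonneg[of n "resid n L (u a)"] by (simp add: ip_def)
    then have "resid n L (u a) i = 0" using i by (simp add: ip_eq_0_iff)
    then show ?thesis using R[OF i, of "u a"] by simp
  qed
  have "orthonormal s r (\<lambda>a l. ip n (e l) (u a))"
    unfolding orthonormal_def
  proof (intro allI impI)
    fix a b assume a: "a < r" and b: "b < r"
    have "ip n (u a) (u b) = ip n (\<lambda>i. \<Sum>l<s. ip n (e l) (u a) * e l i) (u b)"
      using exp[OF a] by (intro ip_cong) auto
    also have "\<dots> = ip s (\<lambda>l. ip n (e l) (u a)) (\<lambda>l. ip n (e l) (u b))"
      by (simp add: ip_sum_left ip_scale_left ip_def[of s])
    finally show "ip s (\<lambda>l. ip n (e l) (u a)) (\<lambda>l. ip n (e l) (u b)) = of_bool (a = b)"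
      using u a b by (simp add: orthonormal_def)
  qed
  then show ?thesis using orthonormal_le s by fastforce
qed

text \<open>Applying \<open>A\<close> to \<open>v a\<close> and dividing by \<open>s a\<close>
  recovers \<open>u a\<close>, so \<open>r\<close> orthonormal vectors lie in a span of
  \<open>mat_rank A\<close> vectors. This makes the singular values beyond the rank vanish.\<close>

lemma rank_ge_of_singular_values:
  assumes A: "A \<in> carrier_mat n m"
    and entries: "\<And>i j. i < n \<Longrightarrow> j < m \<Longrightarrow> A $$ (i, j) = (\<Sum>l<m. u l i * s l * v l j)"
    and u: "orthonormal n m u" and v: "orthonormal m m v"
    and r: "r \<le> m" "\<And>l. l < r \<Longrightarrow> s l \<noteq> 0"
  shows "r \<le> mat_rank A"
proof -
  obtain L where len: "length L = mat_rank A"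
    and L: "\<And>j. j < m \<Longrightarrow> \<exists>c. \<forall>i<n. A $$ (i, j) = (\<Sum>l<length L. c l * (L ! l) i)"
    by (rule rank_column_span[OF A]) blast
  obtain c where c: "\<And>i j. j < m \<Longrightarrow> i < n \<Longrightarrow> A $$ (i, j) = (\<Sum>l<length L. c j l * (L ! l) i)"
    using L by metis
  have "\<exists>d. \<forall>i<n. u a i = (\<Sum>l<length L. d l * (L ! l) i)" if a: "a < r" for a
  proof (intro exI allI impI)
    fix i assume i: "i < n"
    have "(\<Sum>j<m. A $$ (i, j) * v a j) = (\<Sum>j<m. \<Sum>l<m. u l i * s l * (v l j * v a j))"
      using i by (simp add: entries sum_distrib_right mult.assoc)
    also have "\<dots> = (\<Sum>l<m. u l i * s l * ip m (v l) (v a))"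
      by (subst sum.swap) (simp add: sum_distrib_left ip_def)
    also have "\<dots> = (\<Sum>l<m. if l = a then u l i * s l else 0)"
      using v a r(1) by (intro sum.cong) (auto simp: orthonormal_def)
    also have "\<dots> = u a i * s a"
      using a r(1) by simp
    finally have "u a i = (\<Sum>j<m. A $$ (i, j) * v a j) / s a"
      using r(2)[OF a] by simp
    also have "\<dots> = (\<Sum>l<length L. (\<Sum>j<m. c j l * v a j / s a) * (L ! l) i)"
      using i by (simp add: c sum_distrib_right sum_divide_distrib) (subst sum.swap, simp add: mult_ac)
    finally show "u a i = (\<Sum>l<length L. (\<Sum>j<m. c j l * v a j / s a) * (L ! l) i)" .
  qed
  moreover have "orthonormal n r u"
    using u r(1) by (simp add: orthonormal_def)
  ultimately have "r \<le> length L"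
    by (rule orthonormal_card_le_span[rotated])
  then show ?thesis by (simp only: len)
qed

text \<open>Each summand has rank at most 1 and rank is subadditive. This makes the singular values
  up to the rank positive where they occur as divisors.\<close>

lemma rank_le_of_product_sum:
  assumes "A \<in> carrier_mat n m"
    and "\<And>i j. i < n \<Longrightarrow> j < m \<Longrightarrow> A $$ (i, j) = (\<Sum>l<k. f l i * g l j)"
  shows "mat_rank A \<le> k"
proof -
  have "vec_space.rank n A \<le> k"
    using assms
  proof (induction k arbitrary: A)
    case 0
    then have "A = 0\<^sub>m n m" by (intro eq_matI) auto
    then show ?case by (simp add: vec_space.rank_0I)
  next
    case (Suc k)
    define B where "B = mat n m (\<lambda>(i, j). \<Sum>l<k. f l i * g l j)"
    define C where "C = mat n m (\<lambda>(i, j). f k i * g k j)"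
    have BC: "B \<in> carrier_mat n m" "C \<in> carrier_mat n m" by (simp_all add: B_def C_def)
    have "A = B + C"
      using Suc.prems by (intro eq_matI) (auto simp: B_def C_def)
    moreover have "vec_space.rank n B \<le> k"
      by (rule Suc.IH) (auto simp: B_def)
    moreover have "vec_space.rank n C \<le> 1"
      by (rule vec_space.rank_le_1_product_entries[OF BC(2)]) (auto simp: C_def)
    ultimately show ?case
      using vec_space.rank_subadditive[OF BC] by simp
  qed
  then show ?thesis using assms(1) by simp
qed

text \<open>The vector \<open>\<lambda> Z c\<close>, with \<open>c\<close> the multiple of the dual row that reproduces \<open>u i\<close> up to
  the components beyond the \<open>k\<close>-th, leaves the squared distance \<open>(1 - \<lambda>)\<^sup>2 + \<lambda>\<^sup>2 \<tau>\<close>, whose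
  minimum over \<open>\<lambda>\<close> is \<open>\<tau> / (1 + \<tau>)\<close>.\<close>

lemma resid_left_vector_le:
  assumes u: "orthonormal n m u" and ik: "i < k" "k \<le> m" and si: "s i \<noteq> 0"
    and Z: "Z \<in> carrier_mat n p"
    and entries: "\<And>x j. x < n \<Longrightarrow> j < p \<Longrightarrow> Z $$ (x, j) = (\<Sum>l<m. u l x * (s l * h l j))"
    and y: "ip p (dual_row p k i h) (dual_row p k i h) \<noteq> 0"
  defines "\<tau> \<equiv> (\<Sum>a\<in>{k..<m}.
      (s a / s i)\<^sup>2 * (ip p (dual_row p k i h) (h a) / ip p (dual_row p k i h) (dual_row p k i h))\<^sup>2)"
  shows "ip n (resid n (column_list Z) (u i)) (resid n (column_list Z) (u i)) \<le> \<tau> / (1 + \<tau>)"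
proof -
  let ?y = "dual_row p k i h"
  define N where "N = ip p ?y ?y"
  have N: "N \<noteq> 0" using y by (simp add: N_def)
  have \<tau>: "0 \<le> \<tau>" unfolding \<tau>_def by (intro sum_nonneg) simp
  define t where "t = 1 / (1 + \<tau>)"
  \<comment> \<open>The vector \<open>Z c\<close> has coefficient \<open>t\<close> at
    \<open>u i\<close>, 0 at the other \<open>u l\<close> with \<open>l < k\<close>, and
    \<open>t\<close> times a term of \<tau> before squaring at each later one; \<open>w\<close>
    collects the coefficients of \<open>u i - Z c\<close>.\<close>
  define c where "c j = t / (N * s i) * ?y j" for j
  define w where "w l = of_bool (l = i) - s l * ip p c (h l)" for l
  have ip_c: "ip p c (h l) = t / (N * s i) * ip p ?y (h l)" for l
    by (simp only: c_def[abs_def] ip_scale_left)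
  define z where "z x = (\<Sum>l<m. w l * u l x)" for x
  have "z x = u i x - (\<Sum>j<length (column_list Z). c j * (column_list Z ! j) x)" if x: "x < n" for x
  proof -
    have "(\<Sum>j<length (column_list Z). c j * (column_list Z ! j) x) = (\<Sum>j<p. c j * Z $$ (x, j))"
      using Z by (intro sum.cong) (auto simp: column_list_def)
    also have "\<dots> = (\<Sum>j<p. \<Sum>l<m. s l * u l x * (c j * h l j))"
      using x by (intro sum.cong refl) (simp add: entries sum_distrib_left mult_ac)
    also have "\<dots> = (\<Sum>l<m. s l * u l x * ip p c (h l))"
      by (subst sum.swap) (simp add: ip_def sum_distrib_left)
    moreover have "(\<Sum>l<m. of_bool (l = i) * u l x) = u i x"
      using ik by (intro sum_of_bool_mult) simp
    ultimately show ?thesis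
      by (simp only: z_def w_def left_diff_distrib sum_subtractf) (simp add: mult_ac)
  qed
  then have "ip n (resid n (column_list Z) (u i)) (resid n (column_list Z) (u i)) \<le> ip n z z"
    by (rule ip_resid_le)
  also have "ip n z z = (\<Sum>l<m. (w l)\<^sup>2)"
    unfolding z_def[abs_def] by (rule ip_orthonormal_combination[OF u])
  also have "\<dots> = (\<Sum>l<k. (w l)\<^sup>2) + (\<Sum>l\<in>{k..<m}. (w l)\<^sup>2)"
    using ik by (subst sum.union_disjoint[symmetric]) (auto intro!: sum.cong)
  also have "(\<Sum>l<k. (w l)\<^sup>2) = (\<Sum>l<k. if l = i then (1 - t)\<^sup>2 else 0)"
  proof (intro sum.cong refl)
    fix l assume l: "l \<in> {..<k}"
    show "(w l)\<^sup>2 = (if l = i then (1 - t)\<^sup>2 else 0)"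
    proof (cases "l = i")
      case True
      have "ip p ?y (h i) = N"
        using dual_row_self[of p h i k] by (simp add: N_def ip_commute)
      then show ?thesis using True N si by (simp add: w_def ip_c)
    next
      case False
      then show ?thesis using l by (simp add: w_def ip_c dual_row_orthogonal)
    qed
  qed
  also have "\<dots> = (1 - t)\<^sup>2"
    using ik by simp
  also have "(\<Sum>l\<in>{k..<m}. (w l)\<^sup>2) = t\<^sup>2 * \<tau>"
    unfolding \<tau>_def sum_distrib_left
    using ik by (intro sum.cong refl)
      (auto simp: w_def ip_c N_def[symmetric] power_mult_distrib power_divide mult_ac)
  also have "(1 - t)\<^sup>2 + t\<^sup>2 * \<tau> = \<tau> / (1 + \<tau>)"
  proof -
    have "1 - t = \<tau> * t" and "1 + \<tau> > 0"
      using \<tau> by (simp_all add: t_def field_simps)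
    have "(1 - t)\<^sup>2 + t\<^sup>2 * \<tau> = \<tau> * t * (t * (1 + \<tau>))"
      unfolding \<open>1 - t = \<tau> * t\<close> by (simp add: power2_eq_square algebra_simps)
    also have "t * (1 + \<tau>) = 1" using \<open>1 + \<tau> > 0\<close> by (simp add: t_def)
    finally show ?thesis by (simp add: t_def)
  qed
  finally show ?thesis .
qed

text \<open>The triangle inequality leaves the projected difference of \<open>A\<close> and
  \<open>T\<close>. In each of its rows the entries are a combination of the orthonormal
  \<open>v l\<close>, so summing squares over the columns removes \<open>v\<close>, and only
  residuals of the \<open>u l\<close> remain.\<close>

lemma frob_norm_orth_proj_diff_le:
  assumes Z: "Z \<in> carrier_mat n p" and A: "A \<in> carrier_mat n m" and T: "T \<in> carrier_mat n m"
    and v: "orthonormal m k v"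
    and AT: "\<And>i j. i < n \<Longrightarrow> j < m \<Longrightarrow> A $$ (i, j) = T $$ (i, j) + (\<Sum>l<k. (c l * v l j) * u l i)"
  shows "frob_norm ((1\<^sub>m n - orth_proj Z) * A) - frob_norm ((1\<^sub>m n - orth_proj Z) * T)
    \<le> sqrt (\<Sum>l<k. (c l)\<^sup>2 * ip n (resid n (column_list Z) (u l)) (resid n (column_list Z) (u l)))"
proof -
  let ?R = "resid n (column_list Z)" and ?S = "{..<m} \<times> {..<n}"
  let ?a = "\<lambda>(j, i). ?R (\<lambda>i. A $$ (i, j)) i" and ?t = "\<lambda>(j, i). ?R (\<lambda>i. T $$ (i, j)) i"
  let ?d = "\<lambda>(j, i). \<Sum>l<k. (c l * ?R (u l) i) * v l j"
  have split: "?a x = ?t x + ?d x" if x: "x \<in> ?S" for x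
  proof -
    obtain j i where ji: "x = (j, i)" "j < m" "i < n" using x by auto
    have "?R (\<lambda>i. A $$ (i, j)) i = ?R (\<lambda>i. T $$ (i, j) + (\<Sum>l<k. (c l * v l j) * u l i)) i"
      using ji by (intro resid_cong) (auto simp: AT)
    also have "\<dots> = ?R (\<lambda>i. T $$ (i, j)) i + (\<Sum>l<k. (c l * v l j) * ?R (u l) i)"
      using ji by (simp add: resid_add resid_linear)
    finally show ?thesis using ji by (simp add: mult_ac)
  qed
  have "L2_set ?a ?S = L2_set (\<lambda>x. ?t x + ?d x) ?S"
    using split by (intro L2_set_cong refl) blast
  also have "\<dots> \<le> L2_set ?t ?S + L2_set ?d ?S"
    by (rule L2_set_triangle_ineq)
  also have "L2_set ?d ?S = sqrt (\<Sum>j<m. \<Sum>i<n. (\<Sum>l<k. (c l * ?R (u l) i) * v l j)\<^sup>2)"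
    by (simp add: L2_set_def sum.cartesian_product case_prod_beta)
  also have "(\<Sum>j<m. \<Sum>i<n. (\<Sum>l<k. (c l * ?R (u l) i) * v l j)\<^sup>2)
      = (\<Sum>i<n. ip m (\<lambda>j. \<Sum>l<k. (c l * ?R (u l) i) * v l j) (\<lambda>j. \<Sum>l<k. (c l * ?R (u l) i) * v l j))"
    by (subst sum.swap) (simp add: ip_def power2_eq_square)
  also have "\<dots> = (\<Sum>i<n. \<Sum>l<k. (c l * ?R (u l) i)\<^sup>2)"
    by (simp only: ip_orthonormal_combination[OF v])
  also have "\<dots> = (\<Sum>l<k. (c l)\<^sup>2 * ip n (?R (u l)) (?R (u l)))"
    by (subst sum.swap) (simp add: ip_def power2_eq_square sum_distrib_left mult_ac)
  finally show ?thesis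
    by (simp add: frob_norm_orth_proj[OF Z A] frob_norm_orth_proj[OF Z T])
qed

text \<open>A bound independent of \<open>Z\<close>, from which integrability of the projected norms
  follows.\<close>

lemma frob_norm_orth_proj_le:
  assumes Z: "Z \<in> carrier_mat n p" and B: "B \<in> carrier_mat n m"
  shows "frob_norm ((1\<^sub>m n - orth_proj Z) * B) \<le> sqrt (\<Sum>j<m. ip n (\<lambda>i. B $$ (i, j)) (\<lambda>i. B $$ (i, j)))"
proof -
  let ?R = "\<lambda>j. resid n (column_list Z) (\<lambda>i. B $$ (i, j))"
  have "frob_norm ((1\<^sub>m n - orth_proj Z) * B) = sqrt (\<Sum>j<m. ip n (?R j) (?R j))"
    by (simp add: frob_norm_orth_proj[OF Z B] L2_set_def sum.cartesian_product case_prod_beta ip_def power2_eq_square)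
  also have "\<dots> \<le> sqrt (\<Sum>j<m. ip n (\<lambda>i. B $$ (i, j)) (\<lambda>i. B $$ (i, j)))"
    by (intro real_sqrt_le_mono sum_mono ip_resid_le[where c="\<lambda>_. 0"]) simp
  finally show ?thesis .
qed

section \<open>Entries of the decomposition, of its tail and of the power matrix\<close>

lemma sing_mat_carrier [simp]: "sing_mat n m \<sigma> \<in> carrier_mat n m"
  by (simp add: sing_mat_def)

lemma orthogonal_matrix_n_columns:
  assumes "orthogonal_matrix_n n U"
  shows "orthonormal n n (\<lambda>l i. U $$ (i, l))"
  unfolding orthonormal_def
proof (intro allI impI)
  fix a b assume ab: "a < n" "b < n"
  have U: "U \<in> carrier_mat n n" "U\<^sup>T * U = 1\<^sub>m n"
    using assms by (auto simp: orthogonal_matrix_n_def)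
  have "ip n (\<lambda>i. U $$ (i, a)) (\<lambda>i. U $$ (i, b)) = (U\<^sup>T * U) $$ (a, b)"
    using U(1) ab by (simp add: ip_def scalar_prod_def atLeast0LessThan)
  also have "\<dots> = of_bool (a = b)"
    using ab by (simp add: U(2))
  finally show "ip n (\<lambda>i. U $$ (i, a)) (\<lambda>i. U $$ (i, b)) = of_bool (a = b)" .
qed

text \<open>The sizes are left free so that the computation also serves the tail, whose factors have
  \<open>n - k\<close> and \<open>m - k\<close> columns.\<close>

lemma svd_product_entry:
  assumes U: "U \<in> carrier_mat n n'" and V: "V \<in> carrier_mat m m'" and "m' \<le> n'"
    and S: "S \<in> carrier_mat n' m'" "\<And>i j. i < n' \<Longrightarrow> j < m' \<Longrightarrow> S $$ (i, j) = (if i = j then s i else 0)"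
    and "i < n" "j < m"
  shows "(U * S * V\<^sup>T) $$ (i, j) = (\<Sum>l<m'. U $$ (i, l) * s l * V $$ (j, l))"
proof -
  have "(U * S) $$ (i, l) = U $$ (i, l) * s l" if "l < m'" for l
  proof -
    have "(U * S) $$ (i, l) = (\<Sum>a<n'. U $$ (i, a) * S $$ (a, l))"
      using assms that by (simp add: scalar_prod_def atLeast0LessThan)
    also have "\<dots> = (\<Sum>a<n'. if a = l then U $$ (i, a) * s a else 0)"
      using S(2) that by (intro sum.cong) auto
    finally show ?thesis using that \<open>m' \<le> n'\<close> by simp
  qed
  moreover have "U * S \<in> carrier_mat n m'"
    using U S(1) by simp
  moreover have "(W * V\<^sup>T) $$ (i, j) = (\<Sum>l<m'. W $$ (i, l) * V $$ (j, l))"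
    if "W \<in> carrier_mat n m'" for W
    using that V \<open>i < n\<close> \<open>j < m\<close> by (simp add: scalar_prod_def atLeast0LessThan)
  ultimately show ?thesis by simp
qed

lemma svd_entry:
  assumes "U \<in> carrier_mat n n" and "V \<in> carrier_mat m m" and "m \<le> n" and "i < n" and "j < m"
  shows "(U * sing_mat n m \<sigma> * V\<^sup>T) $$ (i, j) = (\<Sum>l<m. U $$ (i, l) * \<sigma> (l + 1) * V $$ (j, l))"
  using assms by (intro svd_product_entry) (auto simp: sing_mat_def)

lemma svd_tail_factor_carriers:
  assumes "U \<in> carrier_mat n n"
  shows "drop_cols k U \<in> carrier_mat n (n - k)"
    and "lower_right_block k (sing_mat n m \<sigma>) \<in> carrier_mat (n - k) (m - k)"
  using carrier_matD[OF assms]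
  by (auto intro!: carrier_matI simp: drop_cols_def lower_right_block_def sing_mat_def)

lemma svd_tail_carrier:
  assumes "U \<in> carrier_mat n n" and "V \<in> carrier_mat m m"
  shows "svd_tail n m k U \<sigma> V \<in> carrier_mat n m"
  unfolding svd_tail_def
  by (rule mult_carrier_mat[OF mult_carrier_mat[OF svd_tail_factor_carriers[OF assms(1)]]])
    (simp add: svd_tail_factor_carriers(1)[OF assms(2)])

lemma svd_tail_entry:
  assumes "U \<in> carrier_mat n n" and "V \<in> carrier_mat m m" and "m \<le> n" and "k \<le> m" and "i < n" and "j < m"
  shows "svd_tail n m k U \<sigma> V $$ (i, j) = (\<Sum>l\<in>{k..<m}. U $$ (i, l) * \<sigma> (l + 1) * V $$ (j, l))"
proof -
  have "svd_tail n m k U \<sigma> V $$ (i, j)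
      = (\<Sum>l<m - k. drop_cols k U $$ (i, l) * \<sigma> (l + k + 1) * drop_cols k V $$ (j, l))"
    unfolding svd_tail_def
    using assms
    by (intro svd_product_entry[OF svd_tail_factor_carriers(1)[OF assms(1)]
          svd_tail_factor_carriers(1)[OF assms(2)] _ svd_tail_factor_carriers(2)[OF assms(1)]])
      (auto simp: lower_right_block_def sing_mat_def)
  also have "\<dots> = (\<Sum>l<m - k. U $$ (i, l + k) * \<sigma> (l + k + 1) * V $$ (j, l + k))"
    using assms by (intro sum.cong) (auto simp: drop_cols_def)
  also have "\<dots> = (\<Sum>l\<in>{k..<m}. U $$ (i, l) * \<sigma> (l + 1) * V $$ (j, l))"
    using assms(4) by (intro sum.reindex_bij_witness[of _ "\<lambda>l. l - k" "\<lambda>l. l + k"]) auto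
  finally show ?thesis .
qed

text \<open>The inner family \<open>g\<close> cancels by orthonormality, so the diagonal factors are
  simply multiplied.\<close>

lemma spectral_mult_entry:
  assumes X: "X \<in> carrier_mat r d" and Y: "Y \<in> carrier_mat d c" and g: "orthonormal d m g"
    and X_entries: "\<And>i j. i < r \<Longrightarrow> j < d \<Longrightarrow> X $$ (i, j) = (\<Sum>l<m. f l i * a l * g l j)"
    and Y_entries: "\<And>i j. i < d \<Longrightarrow> j < c \<Longrightarrow> Y $$ (i, j) = (\<Sum>l<m. g l i * b l * h l j)"
    and ij: "i < r" "j < c"
  shows "(X * Y) $$ (i, j) = (\<Sum>l<m. f l i * (a l * b l) * h l j)"
proof -
  have "(X * Y) $$ (i, j) = (\<Sum>x<d. X $$ (i, x) * Y $$ (x, j))"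
    using X Y ij by (simp add: scalar_prod_def atLeast0LessThan)
  also have "\<dots> = ip d (\<lambda>x. \<Sum>l<m. (f l i * a l) * g l x) (\<lambda>x. \<Sum>l<m. (b l * h l j) * g l x)"
    unfolding ip_def using ij by (intro sum.cong refl) (simp add: X_entries Y_entries mult_ac)
  also have "\<dots> = (\<Sum>l<m. (f l i * a l) * (\<Sum>l'<m. (b l' * h l' j) * ip d (g l) (g l')))"
    by (simp only: ip_sum_left ip_scale_left ip_sum_right ip_scale_right)
  also have "\<dots> = (\<Sum>l<m. (f l i * a l) * (\<Sum>l'<m. of_bool (l' = l) * (b l' * h l' j)))"
  proof (intro sum.cong refl)
    fix l assume l: "l \<in> {..<m}"
    have "(\<Sum>l'<m. b l' * h l' j * ip d (g l) (g l')) = (\<Sum>l'<m. of_bool (l' = l) * (b l' * h l' j))"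
      using g l by (intro sum.cong refl) (auto simp: orthonormal_def)
    then show "f l i * a l * (\<Sum>l'<m. b l' * h l' j * ip d (g l) (g l'))
        = f l i * a l * (\<Sum>l'<m. of_bool (l' = l) * (b l' * h l' j))"
      by (simp only:)
  qed
  also have "\<dots> = (\<Sum>l<m. f l i * (a l * b l) * h l j)"
  proof (intro sum.cong refl)
    fix l assume "l \<in> {..<m}"
    then have "(\<Sum>l'<m. of_bool (l' = l) * (b l' * h l' j)) = b l * h l j"
      by (intro sum_of_bool_mult) simp
    then show "f l i * a l * (\<Sum>l'<m. of_bool (l' = l) * (b l' * h l' j)) = f l i * (a l * b l) * h l j"
      by (simp only: mult.assoc)
  qed
  finally show ?thesis .
qed

lemma power_mat_svd:
  assumes svd: "is_svd n m A U \<sigma> V" and mn: "m \<le> n"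
  shows "power_mat q A = U * sing_mat n m (\<lambda>i. \<sigma> i ^ (2 * q + 1)) * V\<^sup>T"
proof -
  have U: "U \<in> carrier_mat n n" and V: "V \<in> carrier_mat m m"
    and A: "A = U * sing_mat n m \<sigma> * V\<^sup>T"
    using svd by (auto simp: is_svd_def orthogonal_matrix_n_def)
  have u: "orthonormal n m (\<lambda>l i. U $$ (i, l))" and v: "orthonormal m m (\<lambda>l j. V $$ (j, l))"
    using orthogonal_matrix_n_columns[of n U] orthogonal_matrix_n_columns[of m V] svd mn
    by (auto simp: is_svd_def orthonormal_def)
  \<comment> \<open>\<open>B \<tau>\<close> keeps the singular vectors of \<open>A\<close> and has
    the values \<tau>. Multiplying by \<open>A * A\<^sup>T\<close> multiplies these values by
    \<open>\<sigma> i ^ 2\<close>, which is iterated \<open>q\<close> times from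
    \<open>A = B \<sigma>\<close>.\<close>
  define B where "B \<tau> = U * sing_mat n m \<tau> * V\<^sup>T" for \<tau>
  have Bc: "B \<tau> \<in> carrier_mat n m" for \<tau>
    unfolding B_def using U V by (intro mult_carrier_mat[of _ _ m] mult_carrier_mat[of _ _ n]) auto
  have Be: "B \<tau> $$ (i, j) = (\<Sum>l<m. U $$ (i, l) * \<tau> (l + 1) * V $$ (j, l))" if "i < n" "j < m" for \<tau> i j
    unfolding B_def using U V mn that by (rule svd_entry)
  have A_B: "A = B \<sigma>" by (simp add: A B_def)
  have Ac: "A \<in> carrier_mat n m" using Bc[of \<sigma>] by (simp add: A_B)
  have AB: "((B \<sigma>)\<^sup>T * B \<tau>) $$ (i, j) = (\<Sum>l<m. V $$ (i, l) * (\<sigma> (l + 1) * \<tau> (l + 1)) * V $$ (j, l))"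
    if ij: "i < m" "j < m" for \<tau> i j
  proof (rule spectral_mult_entry[OF _ Bc u _ Be ij])
    show "(B \<sigma>)\<^sup>T \<in> carrier_mat m n" using Bc by simp
    show "(B \<sigma>)\<^sup>T $$ (i, j) = (\<Sum>l<m. V $$ (i, l) * \<sigma> (l + 1) * U $$ (j, l))"
      if "i < m" "j < n" for i j
      using that carrier_matD[OF Bc[of \<sigma>]] by (simp add: Be mult_ac)
  qed
  have AAB: "B \<sigma> * ((B \<sigma>)\<^sup>T * B \<tau>) = B (\<lambda>i. \<sigma> i ^ 2 * \<tau> i)" (is "_ = ?B") for \<tau>
  proof (rule eq_matI)
    have AtB: "(B \<sigma>)\<^sup>T * B \<tau> \<in> carrier_mat m m"
      using Bc by (intro mult_carrier_mat[of _ _ n]) auto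
    show "dim_row (B \<sigma> * ((B \<sigma>)\<^sup>T * B \<tau>)) = dim_row ?B" "dim_col (B \<sigma> * ((B \<sigma>)\<^sup>T * B \<tau>)) = dim_col ?B"
      using carrier_matD[OF Bc[of \<sigma>]] carrier_matD[OF Bc[of \<tau>]] carrier_matD[OF Bc[of "\<lambda>i. \<sigma> i ^ 2 * \<tau> i"]]
      by simp_all
    fix i j assume "i < dim_row ?B" "j < dim_col ?B"
    then have ij: "i < n" "j < m" using carrier_matD[OF Bc[of "\<lambda>i. \<sigma> i ^ 2 * \<tau> i"]] by auto
    have "(B \<sigma> * ((B \<sigma>)\<^sup>T * B \<tau>)) $$ (i, j)
        = (\<Sum>l<m. U $$ (i, l) * (\<sigma> (l + 1) * (\<sigma> (l + 1) * \<tau> (l + 1))) * V $$ (j, l))"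
      by (rule spectral_mult_entry[OF Bc AtB v Be AB ij])
    then show "(B \<sigma> * ((B \<sigma>)\<^sup>T * B \<tau>)) $$ (i, j) = ?B $$ (i, j)"
      using ij by (simp add: Be power2_eq_square mult_ac)
  qed
  have AAc: "A * A\<^sup>T \<in> carrier_mat n n" using Ac by simp
  have "(A * A\<^sup>T) ^\<^sub>m q * B \<tau> = B (\<lambda>i. \<sigma> i ^ (2 * q) * \<tau> i)" for \<tau>
  proof (induction q arbitrary: \<tau>)
    case 0
    then show ?case using Bc[of \<tau>] carrier_matD[OF AAc] by simp
  next
    case (Suc q)
    have "(A * A\<^sup>T) ^\<^sub>m Suc q * B \<tau> = (A * A\<^sup>T) ^\<^sub>m q * ((A * A\<^sup>T) * B \<tau>)"
      using AAc Bc[of \<tau>] assoc_mult_mat[of "(A * A\<^sup>T) ^\<^sub>m q" n n "A * A\<^sup>T" n "B \<tau>" m] by simp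
    also have "(A * A\<^sup>T) * B \<tau> = B (\<lambda>i. \<sigma> i ^ 2 * \<tau> i)"
      using assoc_mult_mat[of A n m "A\<^sup>T" n "B \<tau>" m] Ac Bc[of \<tau>] by (simp add: A_B AAB)
    finally show ?case
      by (simp add: Suc.IH power_add power2_eq_square mult_ac)
  qed
  from this[of \<sigma>] show ?thesis
    by (simp add: power_mat_def A_B B_def[symmetric] mult.commute)
qed

section \<open>The expected error\<close>

text \<open>With \<open>e\<close> the columns of \<open>V\<close> these are the rows of
  \<open>V\<^sup>T * B\<close>, arranged as a point of the product space of rows.\<close>

definition rotated_rows :: "nat \<Rightarrow> nat \<Rightarrow> (nat \<Rightarrow> nat \<Rightarrow> real) \<Rightarrow> real mat \<Rightarrow> nat \<Rightarrow> nat \<Rightarrow> real" where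
  "rotated_rows m p e B = (\<lambda>a\<in>{..<m}. \<lambda>j\<in>{..<p}. ip m (e a) (\<lambda>l. B $$ (l, j)))"

lemma (in prob_space) std_gaussian_dual_row:
  assumes G: "std_gaussian_matrix M m p G" and e: "orthonormal m m e"
    and ik: "i < k" and kp: "k + 1 < p" and km: "k \<le> m"
  defines "H \<equiv> \<lambda>\<omega>. rotated_rows m p e (G \<omega>)"
  defines "y \<equiv> \<lambda>\<omega>. dual_row p k i (H \<omega>)"
  shows "AE \<omega> in M. ip p (y \<omega>) (y \<omega>) \<noteq> 0"
    and "k \<le> a \<Longrightarrow> a < m \<Longrightarrow> integrable M (\<lambda>\<omega>. (ip p (y \<omega>) (H \<omega> a) / ip p (y \<omega>) (y \<omega>))\<^sup>2)"
    and "k \<le> a \<Longrightarrow> a < m \<Longrightarrow>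
      expectation (\<lambda>\<omega>. (ip p (y \<omega>) (H \<omega> a) / ip p (y \<omega>) (y \<omega>))\<^sup>2) \<le> 1 / (real p - real k - 1)"
proof -
  let ?R = "std_normal_rows p {..<m}"
  have H_m: "H \<in> measurable M ?R" and H_law: "distr M ?R H = ?R"
    using std_gaussian_rows[OF G e] ik kp km by (simp_all add: H_def[abs_def] rotated_rows_def[abs_def])
  have sub: "{..<k} \<subseteq> {..<m}" using km by auto
  note dual_m = measurable_dual_row[OF ik sub]
  have c: "0 \<le> 1 / (real p - real k - 1)" using kp by simp
  let ?f = "\<lambda>h. inverse (ennreal (ip p (dual_row p k i h) (dual_row p k i h)))"
  have f: "?f \<in> borel_measurable ?R"
    using dual_m
    by (intro borel_measurable_inverse_ennreal measurable_compose[OF _ measurable_ennreal] measurable_ip) auto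
  have "(\<integral>\<^sup>+\<omega>. ?f (H \<omega>) \<partial>M) = (\<integral>\<^sup>+h. ?f h \<partial>?R)"
    using nn_integral_distr[OF H_m, of ?f] f by (simp add: H_law)
  also have "\<dots> \<le> ennreal (1 / (real p - real k - 1))"
    using ik kp sub by (intro nn_integral_inverse_dual_row_le) auto
  \<comment> \<open>A zero dual row would make the inverse infinite, so the finite integral excludes
    this almost surely.\<close>
  finally have "(\<integral>\<^sup>+\<omega>. ?f (H \<omega>) \<partial>M) \<noteq> \<infinity>"
    by (auto simp: top_unique)
  then have "AE \<omega> in M. ?f (H \<omega>) \<noteq> \<infinity>"
    using measurable_compose[OF H_m f] by (intro nn_integral_PInf_AE) auto
  then show "AE \<omega> in M. ip p (y \<omega>) (y \<omega>) \<noteq> 0"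
    by eventually_elim (auto simp: y_def)
  assume a: "k \<le> a" "a < m"
  let ?g = "\<lambda>h. (ip p (dual_row p k i h) (h a) / ip p (dual_row p k i h) (dual_row p k i h))\<^sup>2"
  have g: "?g \<in> borel_measurable ?R"
    using dual_m measurable_std_normal_rows_entry[of a "{..<m}"] a
    by (intro borel_measurable_power borel_measurable_divide measurable_ip) auto
  have gH: "(\<lambda>\<omega>. ?g (H \<omega>)) \<in> borel_measurable M"
    by (rule measurable_compose[OF H_m g])
  have "(\<integral>\<^sup>+\<omega>. ennreal (?g (H \<omega>)) \<partial>M) = (\<integral>\<^sup>+h. ennreal (?g h) \<partial>?R)"
    using nn_integral_distr[OF H_m, of "\<lambda>h. ennreal (?g h)"] g by (simp add: H_law)
  also have "\<dots> \<le> ennreal (1 / (real p - real k - 1))"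
    using ik kp sub a by (intro nn_integral_dual_row_square_le) auto
  finally have le: "(\<integral>\<^sup>+\<omega>. ennreal (?g (H \<omega>)) \<partial>M) \<le> ennreal (1 / (real p - real k - 1))" .
  have int: "integrable M (\<lambda>\<omega>. ?g (H \<omega>))"
  proof (rule integrableI_nonneg[OF gH])
    show "AE \<omega> in M. 0 \<le> ?g (H \<omega>)" by (rule AE_I2) (rule zero_le_power2)
    show "(\<integral>\<^sup>+\<omega>. ennreal (?g (H \<omega>)) \<partial>M) < \<infinity>" by (rule le_less_trans[OF le]) simp
  qed
  then show "integrable M (\<lambda>\<omega>. (ip p (y \<omega>) (H \<omega> a) / ip p (y \<omega>) (y \<omega>))\<^sup>2)"
    by (simp add: y_def)
  have "(\<integral>\<^sup>+\<omega>. ennreal (?g (H \<omega>)) \<partial>M) = ennreal (expectation (\<lambda>\<omega>. ?g (H \<omega>)))"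
    by (rule nn_integral_eq_integral[OF int]) (rule AE_I2, rule zero_le_power2)
  then have "ennreal (expectation (\<lambda>\<omega>. ?g (H \<omega>))) \<le> ennreal (1 / (real p - real k - 1))"
    using le by (simp only:)
  then show "expectation (\<lambda>\<omega>. (ip p (y \<omega>) (H \<omega> a) / ip p (y \<omega>) (y \<omega>))\<^sup>2) \<le> 1 / (real p - real k - 1)"
    unfolding y_def by (simp only: ennreal_le_iff[OF c])
qed

text \<open>The right-hand side is the tangent at \<open>x\<close> to the concave function
  \<open>t / (1 + t)\<close>. It stands in for Jensen's inequality: linearity of the expectation
  then suffices.\<close>

lemma tangent_bound:
  fixes t x :: real
  assumes "0 \<le> t" and "0 \<le> x"
  shows "t / (1 + t) \<le> x / (1 + x) + (t - x) / (1 + x)\<^sup>2"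
proof -
  have "x / (1 + x) + (t - x) / (1 + x)\<^sup>2 - t / (1 + t) = (t - x)\<^sup>2 / ((1 + x)\<^sup>2 * (1 + t))"
    using assms by (simp add: divide_simps power2_eq_square) (simp add: algebra_simps)
  also have "\<dots> \<ge> 0" using assms by simp
  finally show ?thesis by simp
qed

lemma phi_sqrt: "0 \<le> x \<Longrightarrow> phi (sqrt x) = sqrt (x / (1 + x))"
  by (simp add: phi_def real_sqrt_divide)

text \<open>The variance of the square root is nonnegative, which bounds its squared mean by the
  mean of \<open>X\<close>.\<close>

lemma (in prob_space) expectation_sqrt_le:
  assumes "integrable M X" and "\<And>\<omega>. 0 \<le> X \<omega>" and "integrable M (\<lambda>\<omega>. sqrt (X \<omega>))"
    and "expectation X \<le> b"
  shows "expectation (\<lambda>\<omega>. sqrt (X \<omega>)) \<le> sqrt b"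
proof -
  have "variance (\<lambda>\<omega>. sqrt (X \<omega>)) = expectation X - (expectation (\<lambda>\<omega>. sqrt (X \<omega>)))\<^sup>2"
    using assms by (subst variance_eq) simp_all
  moreover have "0 \<le> variance (\<lambda>\<omega>. sqrt (X \<omega>))"
    by (rule variance_positive)
  ultimately show ?thesis
    using assms(4) by (intro real_le_rsqrt) simp
qed

text \<open>Integrability belongs to the conclusion because the expectation of a non-integrable
  function is 0 by default, and the bound alone would then say nothing.\<close>

theorem corollary4p3:
  fixes A U V :: "real mat"
    and \<sigma> :: "nat \<Rightarrow> real"
    and n m p q k :: nat
    and M :: "'w measure"
    and G Z \<Omega> :: "'w \<Rightarrow> real mat"
  assumes "n \<ge> m"
    and "A \<in> carrier_mat n m"
    and "is_svd n m A U \<sigma> V"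
    and "2 < p" and "p \<le> mat_rank A"
    and "k \<in> {1..p - 2}"
    and "prob_space M"
    and "std_gaussian_matrix M m p G"
    and Z: "\<And>\<omega>. Z \<omega> = power_mat q A * G \<omega>"
    and \<Omega>: "\<And>\<omega>. \<Omega> \<omega> = (first_cols k U)\<^sup>T * Z \<omega>"
    and "AE \<omega> in M. mat_rank (\<Omega> \<omega>) = k"
  defines "D \<equiv> (\<lambda>\<omega>. frob_norm ((1\<^sub>m n - orth_proj (Z \<omega>)) * A)
                   - frob_norm ((1\<^sub>m n - orth_proj (Z \<omega>)) * svd_tail n m k U \<sigma> V))"
  shows "integrable M D \<and>
         prob_space.expectation M D \<le>
           min (sqrt (a_bound \<sigma> (mat_rank A) p q k))
               (sqrt (real k) * phi (1 / sqrt (real k) * sqrt (b_bound \<sigma> (mat_rank A) p q k)) * \<sigma> 1)"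
proof -

  \<comment> \<open>Coordinates of \<open>A\<close> and its tail, and vanishing of singular
    values\<close>
  interpret prob_space M by fact
  note mn = assms(1) and Ac = assms(2) and svd = assms(3) and G = assms(8)
  have Uc: "U \<in> carrier_mat n n" and Vc: "V \<in> carrier_mat m m"
    and mono: "\<And>i j. 1 \<le> i \<Longrightarrow> i \<le> j \<Longrightarrow> j \<le> m \<Longrightarrow> \<sigma> j \<le> \<sigma> i"
    and nonneg: "\<And>i. 1 \<le> i \<Longrightarrow> i \<le> m \<Longrightarrow> 0 \<le> \<sigma> i"
    and A_eq: "A = U * sing_mat n m \<sigma> * V\<^sup>T"
    using svd by (auto simp: is_svd_def orthogonal_matrix_n_def)
  define r where "r = mat_rank A"
  define u where "u l i = U $$ (i, l)" for l i
  define v where "v l j = V $$ (j, l)" for l j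
  \<comment> \<open>The singular values of the power matrix; indices start at 0 here and at 1 for
    \<sigma>.\<close>
  define s where "s l = \<sigma> (l + 1) ^ (2 * q + 1)" for l
  define T where "T = svd_tail n m k U \<sigma> V"
  have k1: "1 \<le> k" and kp: "k + 1 < p" using assms(4,6) by auto
  have rm: "r \<le> m"
    using vec_space.rank_le_nc[OF Ac] Ac by (simp add: r_def)
  have kr: "k + 1 < r" using kp assms(5) by (simp add: r_def)
  then have km: "k < m" using rm by simp
  have u: "orthonormal n m u" and v: "orthonormal m m v"
    using orthogonal_matrix_n_columns[of n U] orthogonal_matrix_n_columns[of m V] svd mn
    by (auto simp: is_svd_def orthonormal_def u_def[abs_def] v_def[abs_def])
  have vk: "orthonormal m k v" using v km by (simp add: orthonormal_def)
  have A_entry: "A $$ (i, j) = (\<Sum>l<m. u l i * \<sigma> (l + 1) * v l j)" if "i < n" "j < m" for i j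
    unfolding A_eq u_def v_def by (rule svd_entry[OF Uc Vc mn that])
  have T_entry: "T $$ (i, j) = (\<Sum>l\<in>{k..<m}. u l i * \<sigma> (l + 1) * v l j)" if "i < n" "j < m" for i j
    unfolding T_def u_def v_def using km by (intro svd_tail_entry[OF Uc Vc mn _ that]) simp
  have Tc: "T \<in> carrier_mat n m" unfolding T_def by (rule svd_tail_carrier[OF Uc Vc])
  have split: "sum f {..<m} = sum f {k..<m} + sum f {..<k}" for f :: "nat \<Rightarrow> real"
    using km by (subst sum.union_disjoint[symmetric]) (auto intro!: sum.cong)
  have AT: "A $$ (i, j) = T $$ (i, j) + (\<Sum>l<k. (\<sigma> (l + 1) * v l j) * u l i)" if "i < n" "j < m" for i j
    unfolding A_entry[OF that] T_entry[OF that] split by (simp add: mult_ac)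
  \<comment> \<open>Otherwise only \<open>k\<close> terms of the decomposition would remain,
    contradicting a rank above \<open>k\<close>.\<close>
  have \<sigma>k: "0 < \<sigma> (k + 1)"
  proof (rule ccontr)
    assume "\<not> 0 < \<sigma> (k + 1)"
    then have z: "\<sigma> (l + 1) = 0" if "k \<le> l" "l < m" for l
      using mono[of "k + 1" "l + 1"] nonneg[of "l + 1"] that by auto
    have "A $$ (i, j) = (\<Sum>l<k. u l i * (\<sigma> (l + 1) * v l j))" if "i < n" "j < m" for i j
      unfolding AT[OF that] T_entry[OF that] using z by (simp add: mult_ac)
    then have "r \<le> k" unfolding r_def by (intro rank_le_of_product_sum[OF Ac])
    then show False using kr by simp
  qed
  have \<sigma>pos: "0 < \<sigma> (l + 1)" if "l < k" for l
    using \<sigma>k mono[of "l + 1" "k + 1"] km that by simp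
  \<comment> \<open>This allows sums up to the rank \<open>r\<close> to be extended to
    \<open>m\<close>.\<close>
  have \<sigma>0: "\<sigma> i = 0" if i: "r < i" "i \<le> m" for i
  proof (rule ccontr)
    assume "\<sigma> i \<noteq> 0"
    then have "0 < \<sigma> i" using nonneg[of i] i by simp
    then have "\<sigma> (l + 1) \<noteq> 0" if "l < i" for l
      using mono[of "l + 1" i] i that by simp
    then have "i \<le> mat_rank A"
      using i A_entry by (intro rank_ge_of_singular_values[OF Ac _ u v]) auto
    then show False using i by (simp add: r_def)
  qed

  \<comment> \<open>The sketch \<open>Z\<close> in rotated coordinates, measurability and
    integrability\<close>
  have Gc: "G \<omega> \<in> carrier_mat m p" if "\<omega> \<in> space M" for \<omega>
    using G that by (simp add: std_gaussian_matrix_def)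
  define H where "H \<omega> = rotated_rows m p v (G \<omega>)" for \<omega>
  define B where "B = power_mat q A"
  have Bc: "B \<in> carrier_mat n m"
    unfolding B_def power_mat_svd[OF svd mn] using Uc Vc
    by (intro mult_carrier_mat[of _ _ m] mult_carrier_mat[of _ _ n]) auto
  have B_entry: "B $$ (i, j) = (\<Sum>l<m. u l i * s l * v l j)" if "i < n" "j < m" for i j
    unfolding B_def power_mat_svd[OF svd mn] u_def v_def s_def by (rule svd_entry[OF Uc Vc mn that])
  have Zc: "Z \<omega> \<in> carrier_mat n p" if "\<omega> \<in> space M" for \<omega>
    unfolding Z B_def[symmetric] by (rule mult_carrier_mat[OF Bc Gc[OF that]])
  have ZG: "Z \<omega> $$ (i, j) = (\<Sum>b<m. B $$ (i, b) * G \<omega> $$ (b, j))"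
    if "\<omega> \<in> space M" "i < n" "j < p" for \<omega> i j
    unfolding Z B_def[symmetric] using Bc Gc[OF that(1)] that(2,3)
    by (simp add: scalar_prod_def atLeast0LessThan)
  have ZH: "Z \<omega> $$ (i, j) = (\<Sum>l<m. u l i * (s l * H \<omega> l j))"
    if "\<omega> \<in> space M" "i < n" "j < p" for \<omega> i j
  proof -
    have "Z \<omega> $$ (i, j) = (\<Sum>b<m. \<Sum>l<m. u l i * (s l * (v l b * G \<omega> $$ (b, j))))"
      unfolding ZG[OF that] using that by (simp add: B_entry sum_distrib_right) (simp add: mult_ac)
    also have "\<dots> = (\<Sum>l<m. u l i * (s l * ip m (v l) (\<lambda>b. G \<omega> $$ (b, j))))"
      by (subst sum.swap) (simp add: ip_def sum_distrib_left)
    finally show ?thesis using that by (simp add: H_def rotated_rows_def)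
  qed
  have G_m: "(\<lambda>\<omega>. G \<omega> $$ (b, j)) \<in> borel_measurable M" if "b < m" "j < p" for b j
  proof -
    have "(\<lambda>\<omega>. \<lambda>i\<in>{..<m}. G \<omega> $$ (i, j)) \<in> measurable M (\<Pi>\<^sub>M i\<in>{..<m}. borel)"
      using G that by (simp add: std_gaussian_matrix_def indep_vars_def)
    from measurable_compose[OF this measurable_coordinate[OF that(1)]] show ?thesis
      using that by simp
  qed
  have Z_m: "(\<lambda>\<omega>. Z \<omega> $$ (i, j)) \<in> borel_measurable M" if "i < n" "j < p" for i j
  proof -
    have "(\<lambda>\<omega>. \<Sum>b<m. B $$ (i, b) * G \<omega> $$ (b, j)) \<in> borel_measurable M"
      using G_m that by (intro borel_measurable_sum borel_measurable_times) auto
    then show ?thesis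
      using ZG that by (subst measurable_cong) auto
  qed
  have resid_m: "(\<lambda>\<omega>. resid n (column_list (Z \<omega>)) x i) \<in> borel_measurable M" if "i < n" for x i
  proof -
    have "(\<lambda>\<omega>. resid n (map (\<lambda>b. b \<omega>) (map (\<lambda>j \<omega> i. Z \<omega> $$ (i, j)) [0..<p])) x i) \<in> borel_measurable M"
      using Z_m that by (intro measurable_resid) auto
    then show ?thesis
      using Zc by (subst measurable_cong[where g="\<lambda>\<omega>. resid n (map (\<lambda>b. b \<omega>) (map (\<lambda>j \<omega> i. Z \<omega> $$ (i, j)) [0..<p])) x i"])
        (auto simp: column_list_def comp_def)
  qed
  have frob_int: "integrable M (\<lambda>\<omega>. frob_norm ((1\<^sub>m n - orth_proj (Z \<omega>)) * C))"
    if C: "C \<in> carrier_mat n m" for C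
  proof (rule integrable_const_bound)
    show "AE \<omega> in M. norm (frob_norm ((1\<^sub>m n - orth_proj (Z \<omega>)) * C))
        \<le> sqrt (\<Sum>j<m. ip n (\<lambda>i. C $$ (i, j)) (\<lambda>i. C $$ (i, j)))"
      using frob_norm_orth_proj_le[OF Zc C]
      by (intro AE_I2) (simp add: frob_norm_def[of "(1\<^sub>m n - _) * _"] sum_nonneg)
    have "(\<lambda>\<omega>. L2_set (\<lambda>(j, i). resid n (column_list (Z \<omega>)) (\<lambda>i. C $$ (i, j)) i) ({..<m} \<times> {..<n}))
        \<in> borel_measurable M"
      unfolding L2_set_def using resid_m
      by (intro measurable_compose[OF _ borel_measurable_sqrt] borel_measurable_sum borel_measurable_power) auto
    then show "(\<lambda>\<omega>. frob_norm ((1\<^sub>m n - orth_proj (Z \<omega>)) * C)) \<in> borel_measurable M"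
      using frob_norm_orth_proj[OF Zc C] by (subst measurable_cong) auto
  qed
  have D_int: "integrable M D"
    unfolding D_def T_def[symmetric] by (intro Bochner_Integration.integrable_diff frob_int Ac Tc)

  \<comment> \<open>Reduction to the residuals of the leading left singular vectors\<close>
  define \<rho> where "\<rho> i \<omega> = ip n (resid n (column_list (Z \<omega>)) (u i)) (resid n (column_list (Z \<omega>)) (u i))" for i \<omega>
  \<comment> \<open>By orthonormality of the \<open>v l\<close> this is the squared Frobenius norm
    of the projected leading part of \<open>A\<close>.\<close>
  define X where "X \<omega> = (\<Sum>i<k. (\<sigma> (i + 1))\<^sup>2 * \<rho> i \<omega>)" for \<omega>
  have \<rho>0: "0 \<le> \<rho> i \<omega>" for i \<omega> unfolding \<rho>_def by (rule ip_nonneg)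
  have \<rho>_m: "\<rho> i \<in> borel_measurable M" for i
    unfolding \<rho>_def[abs_def] using resid_m by (intro measurable_ip) auto
  have \<rho>1: "\<rho> i \<omega> \<le> ip n (u i) (u i)" for i \<omega>
    unfolding \<rho>_def by (rule ip_resid_le[where c="\<lambda>_. 0"]) simp
  have \<rho>_int: "integrable M (\<rho> i)" for i
    using \<rho>0 \<rho>1 \<rho>_m by (intro integrable_const_bound[where B="ip n (u i) (u i)"]) auto
  have X0: "0 \<le> X \<omega>" for \<omega> unfolding X_def using \<rho>0 by (intro sum_nonneg) simp
  have X_int: "integrable M X" unfolding X_def[abs_def] using \<rho>_int by auto
  have sqrt_int: "integrable M (\<lambda>\<omega>. sqrt (X \<omega>))"
  proof (rule Bochner_Integration.integrable_bound)
    show "integrable M (\<lambda>\<omega>. 1 + X \<omega>)" using X_int by simp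
    show "(\<lambda>\<omega>. sqrt (X \<omega>)) \<in> borel_measurable M" using X_int by auto
    have "sqrt x \<le> 1 + x" if "0 \<le> x" for x
      using that by (intro real_le_lsqrt) (auto simp: power2_eq_square algebra_simps)
    then show "AE \<omega> in M. norm (sqrt (X \<omega>)) \<le> norm (1 + X \<omega>)"
      using X0 by (intro AE_I2) simp
  qed
  have "D \<omega> \<le> sqrt (X \<omega>)" if "\<omega> \<in> space M" for \<omega>
    unfolding D_def X_def \<rho>_def T_def[symmetric]
    by (rule frob_norm_orth_proj_diff_le[OF Zc[OF that] Ac Tc vk AT])
  then have ED: "expectation D \<le> expectation (\<lambda>\<omega>. sqrt (X \<omega>))"
    by (intro integral_mono D_int sqrt_int)
  have EX: "expectation X = (\<Sum>i<k. (\<sigma> (i + 1))\<^sup>2 * expectation (\<rho> i))"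
    unfolding X_def using \<rho>_int by simp

  \<comment> \<open>Mean of the ratio \<tau> and its comparison with \<rho>\<close>
  define y where "y i \<omega> = dual_row p k i (H \<omega>)" for i \<omega>
  define \<tau> where "\<tau> i \<omega> = (\<Sum>a\<in>{k..<m}. (s a / s i)\<^sup>2 * (ip p (y i \<omega>) (H \<omega> a) / ip p (y i \<omega>) (y i \<omega>))\<^sup>2)" for i \<omega>
  \<comment> \<open>The mean of \<open>\<tau> i\<close> is at most
    \<open>c * S / (s i)\<^sup>2\<close>; both \<open>a_bound\<close> and \<open>b_bound\<close>
    turn out to be weighted sums of these numbers.\<close>
  define S where "S = (\<Sum>a\<in>{k..<m}. (s a)\<^sup>2)"
  define c where "c = 1 / (real p - real k - 1)"
  have c0: "0 < c" using kp by (simp add: c_def)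
  have S0: "0 \<le> S" unfolding S_def by (intro sum_nonneg) simp
  note dual = std_gaussian_dual_row[OF G v _ kp less_imp_le[OF km], folded H_def, folded y_def]
  have \<tau>0: "0 \<le> \<tau> i \<omega>" for i \<omega> unfolding \<tau>_def by (intro sum_nonneg) simp
  have \<tau>_int: "integrable M (\<tau> i)" if "i < k" for i
    unfolding \<tau>_def[abs_def] using dual(2)[OF that] by (intro Bochner_Integration.integrable_sum integrable_mult_right) auto
  have E\<tau>: "expectation (\<tau> i) \<le> c * S / (s i)\<^sup>2" if i: "i < k" for i
  proof -
    have "expectation (\<tau> i) = (\<Sum>a\<in>{k..<m}. (s a / s i)\<^sup>2 *
        expectation (\<lambda>\<omega>. (ip p (y i \<omega>) (H \<omega> a) / ip p (y i \<omega>) (y i \<omega>))\<^sup>2))"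
      unfolding \<tau>_def[abs_def] using dual(2)[OF i]
      by (subst Bochner_Integration.integral_sum) (auto simp del: power_divide)
    also have "\<dots> \<le> (\<Sum>a\<in>{k..<m}. (s a / s i)\<^sup>2 * c)"
      using dual(3)[OF i] by (intro sum_mono mult_left_mono) (auto simp: c_def)
    also have "\<dots> = c * S / (s i)\<^sup>2"
      by (simp add: S_def power_divide sum_distrib_left sum_divide_distrib mult.commute)
    finally show ?thesis .
  qed
  have \<rho>\<tau>: "AE \<omega> in M. \<rho> i \<omega> \<le> \<tau> i \<omega> / (1 + \<tau> i \<omega>)" if i: "i < k" for i
    using dual(1)[OF i] AE_space
  proof eventually_elim
    case (elim \<omega>)
    have "s i \<noteq> 0" using \<sigma>pos[OF i] by (simp add: s_def)
    from elim(1) show ?case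
      unfolding \<rho>_def \<tau>_def y_def
      by (intro resid_left_vector_le[where h="H \<omega>", OF u i less_imp_le[OF km] \<open>s i \<noteq> 0\<close>
            Zc[OF elim(2)] ZH[OF elim(2)]])
  qed

  \<comment> \<open>The two constants in terms of the means of \<tau>\<close>
  have tail_sum: "(\<Sum>i = k + 1..r. 1 / gamma_ratio \<sigma> k i ^ (4 * q + 2)) = S / \<sigma> (k + 1) ^ (4 * q + 2)"
  proof -
    have "(\<Sum>i = k + 1..r. 1 / gamma_ratio \<sigma> k i ^ (4 * q + 2))
        = (\<Sum>i = k + 1..r. \<sigma> i ^ (4 * q + 2)) / \<sigma> (k + 1) ^ (4 * q + 2)"
      by (simp add: gamma_ratio_def power_divide sum_divide_distrib)
    also have "(\<Sum>i = k + 1..r. \<sigma> i ^ (4 * q + 2)) = (\<Sum>i = k + 1..m. \<sigma> i ^ (4 * q + 2))"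
      using rm \<sigma>0 by (intro sum.mono_neutral_left) auto
    also have "\<dots> = (\<Sum>a\<in>{k..<m}. \<sigma> (a + 1) ^ (4 * q + 2))"
      by (intro sum.reindex_bij_witness[of _ "\<lambda>a. a + 1" "\<lambda>i. i - 1"]) auto
    also have "\<dots> = S"
      unfolding S_def s_def by (intro sum.cong refl) (simp add: power_mult[symmetric] power2_eq_square power_add[symmetric])
    finally show ?thesis .
  qed
  have head_sum: "(\<Sum>i = 1..k. gamma_ratio \<sigma> k i ^ N) = \<sigma> (k + 1) ^ N * (\<Sum>i<k. 1 / \<sigma> (i + 1) ^ N)" for N
  proof -
    have "(\<Sum>i = 1..k. gamma_ratio \<sigma> k i ^ N) = (\<Sum>i<k. gamma_ratio \<sigma> k (i + 1) ^ N)"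
      by (intro sum.reindex_bij_witness[of _ "\<lambda>a. a + 1" "\<lambda>i. i - 1"]) auto
    then show ?thesis
      by (simp add: gamma_ratio_def power_divide sum_distrib_left)
  qed
  have s2: "(s i)\<^sup>2 = \<sigma> (i + 1) ^ (4 * q + 2)" for i
    by (simp add: s_def power_mult[symmetric] power2_eq_square power_add[symmetric])
  have b_eq: "b_bound \<sigma> r p q k = (\<Sum>i<k. c * S / (s i)\<^sup>2)"
    unfolding b_bound_def tail_sum head_sum s2
    using \<sigma>k by (simp add: c_def sum_distrib_left)
  have a_eq: "a_bound \<sigma> r p q k = (\<Sum>i<k. (\<sigma> (i + 1))\<^sup>2 * (c * S / (s i)\<^sup>2))"
  proof -
    have "a_bound \<sigma> r p q k = c * S * (\<Sum>i<k. 1 / \<sigma> (i + 1) ^ (4 * q))"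
      unfolding a_bound_def tail_sum head_sum
      using \<sigma>k by (simp add: c_def power_add power2_eq_square)
    also have "\<dots> = (\<Sum>i<k. (\<sigma> (i + 1))\<^sup>2 * (c * S / (s i)\<^sup>2))"
      unfolding sum_distrib_left s2
    proof (intro sum.cong refl)
      fix i assume "i \<in> {..<k}"
      then have "\<sigma> (i + 1) \<noteq> 0" using \<sigma>pos[of i] by simp
      then show "c * S * (1 / \<sigma> (i + 1) ^ (4 * q)) = (\<sigma> (i + 1))\<^sup>2 * (c * S / \<sigma> (i + 1) ^ (4 * q + 2))"
        by (simp add: power_add power2_eq_square)
    qed
    finally show ?thesis .
  qed

  \<comment> \<open>The bound by \<open>a_bound\<close>\<close>
  have "expectation X \<le> a_bound \<sigma> r p q k"
    unfolding EX a_eq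
  proof (intro sum_mono mult_left_mono)
    fix i assume "i \<in> {..<k}"
    then have i: "i < k" by simp
    have "AE \<omega> in M. \<rho> i \<omega> \<le> \<tau> i \<omega>"
      using \<rho>\<tau>[OF i]
    proof eventually_elim
      case (elim \<omega>)
      have "\<tau> i \<omega> / (1 + \<tau> i \<omega>) \<le> \<tau> i \<omega> / 1"
        using \<tau>0[of i \<omega>] by (intro divide_left_mono) auto
      then show ?case using elim by simp
    qed
    then have "expectation (\<rho> i) \<le> expectation (\<tau> i)"
      by (intro integral_mono_AE \<rho>_int \<tau>_int i)
    then show "expectation (\<rho> i) \<le> c * S / (s i)\<^sup>2" using E\<tau>[OF i] by simp
  qed simp
  then have a: "expectation (\<lambda>\<omega>. sqrt (X \<omega>)) \<le> sqrt (a_bound \<sigma> r p q k)"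
    by (intro expectation_sqrt_le X_int X0 sqrt_int)

  \<comment> \<open>The bound by \<open>b_bound\<close>\<close>
  define x where "x = b_bound \<sigma> r p q k / real k"
  have b0: "0 \<le> b_bound \<sigma> r p q k" unfolding b_eq using c0 S0 by (intro sum_nonneg) simp
  then have x0: "0 \<le> x" by (simp add: x_def)
  have bx: "b_bound \<sigma> r p q k = real k * x" using k1 by (simp add: x_def)
  have \<sigma>1: "0 \<le> \<sigma> 1" using nonneg[of 1] km by simp
  \<comment> \<open>The weights are first raised to the largest one, so that with equal weights the
    linear terms of the tangents can cancel.\<close>
  have "expectation X \<le> (\<sigma> 1)\<^sup>2 * (\<Sum>i<k. expectation (\<rho> i))"
    unfolding EX sum_distrib_left
  proof (intro sum_mono mult_right_mono power_mono)
    fix i assume i: "i \<in> {..<k}"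
    then show "\<sigma> (i + 1) \<le> \<sigma> 1" "0 \<le> \<sigma> (i + 1)"
      using mono[of 1 "i + 1"] nonneg[of "i + 1"] km by auto
    show "0 \<le> expectation (\<rho> i)" using \<rho>0 by simp
  qed
  \<comment> \<open>All tangents are taken at the same point \<open>x\<close>, the average of the
    \<open>c * S / (s i)\<^sup>2\<close>; for this choice the linear terms sum to 0.\<close>
  also have "(\<Sum>i<k. expectation (\<rho> i)) \<le> (\<Sum>i<k. x / (1 + x) + (c * S / (s i)\<^sup>2 - x) / (1 + x)\<^sup>2)"
  proof (rule sum_mono)
    fix i assume "i \<in> {..<k}"
    then have i: "i < k" by simp
    have "expectation (\<rho> i) \<le> expectation (\<lambda>\<omega>. x / (1 + x) + (\<tau> i \<omega> - x) / (1 + x)\<^sup>2)"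
    proof (rule integral_mono_AE)
      show "AE \<omega> in M. \<rho> i \<omega> \<le> x / (1 + x) + (\<tau> i \<omega> - x) / (1 + x)\<^sup>2"
        using \<rho>\<tau>[OF i] by eventually_elim (rule order_trans[OF _ tangent_bound[OF \<tau>0 x0]])
    qed (use \<rho>_int \<tau>_int[OF i] in auto)
    also have "\<dots> = x / (1 + x) + (expectation (\<tau> i) - x) / (1 + x)\<^sup>2"
      using \<tau>_int[OF i] by (simp add: prob_space)
    also have "\<dots> \<le> x / (1 + x) + (c * S / (s i)\<^sup>2 - x) / (1 + x)\<^sup>2"
      using E\<tau>[OF i] by (intro add_left_mono divide_right_mono) auto
    finally show "expectation (\<rho> i) \<le> x / (1 + x) + (c * S / (s i)\<^sup>2 - x) / (1 + x)\<^sup>2" .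
  qed
  also have "\<dots> = real k * (x / (1 + x)) + (b_bound \<sigma> r p q k - real k * x) / (1 + x)\<^sup>2"
    by (simp add: b_eq sum.distrib sum_subtractf sum_divide_distrib[symmetric])
  also have "\<dots> = real k * (x / (1 + x))"
    by (simp add: bx)
  finally have "expectation X \<le> (\<sigma> 1)\<^sup>2 * (real k * (x / (1 + x)))"
    by (simp add: mult_left_mono)
  then have "expectation (\<lambda>\<omega>. sqrt (X \<omega>)) \<le> sqrt ((\<sigma> 1)\<^sup>2 * (real k * (x / (1 + x))))"
    by (intro expectation_sqrt_le X_int X0 sqrt_int)
  also have "\<dots> = sqrt (real k) * phi (1 / sqrt (real k) * sqrt (b_bound \<sigma> r p q k)) * \<sigma> 1"
  proof -
    have "1 / sqrt (real k) * sqrt (b_bound \<sigma> r p q k) = sqrt x"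
      by (simp add: x_def real_sqrt_divide)
    then show ?thesis
      using x0 \<sigma>1 by (simp only: phi_sqrt real_sqrt_mult real_sqrt_abs abs_of_nonneg mult_ac)
  qed
  finally have b: "expectation (\<lambda>\<omega>. sqrt (X \<omega>))
      \<le> sqrt (real k) * phi (1 / sqrt (real k) * sqrt (b_bound \<sigma> r p q k)) * \<sigma> 1" .
  show ?thesis
    using D_int ED a b by (simp add: r_def)
qed

end
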